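(* Let $V$ be a VOA over $\mathbb{Q}$, and let $N\le \mathrm{Aut}(V)$ be a finite group containing a normal subgroup $E\cong(\mathbb{Z}/2)^r$ with $r\ge 2$, such that $N$ acts (by conjugation) transitively on the nontrivial linear characters of $E$. Let $D\le E$ with $\mathrm{rank}(E/D)\ge1$, and let $W=V^D$ be the fixed-point subVOA. Suppose $W$ has a finitely generated integral form $K$ which is nearly lattice integral. Then: (i) every integral form $J$ in $V$ contains a finitely generated integral form $J'$ which is nearly lattice integral; (ii) if moreover $G$ is a finite subgroup of $\mathrm{Aut}(V)$ and $J$ is $G$-invariant, then $J'$ may be chosen to be $G$-invariant and to satisfy $J'\cap\mathbb{Q}\mathbf{1}=J\cap\mathbb{Q}\mathbf{1}$ and $J'\cap\mathbb{Q}\omega=J\cap\mathbb{Q}\omega$.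
   Context: $V$ carries its natural (nondegenerate invariant) bilinear form $\langle\ ,\ \rangle$; $\mathbf{1}$ is the vacuum and $\omega$ the conformal vector. An integral form (IF) in a VOA is an additive subgroup which is the $\mathbb{Z}$-span of a $\mathbb{Q}$-basis, closed under all products $a_kb$ ($k\in\mathbb{Z}$), and containing a positive integer multiple of $\mathbf{1}$ and of $\omega$. An IF is finitely generated if it is the smallest additive subgroup closed under all products containing some finite set. An additive subgroup $A$ is lattice integral if $\langle A,A\rangle\subseteq\mathbb{Z}$ and nearly lattice integral if $mA$ is lattice integral for some integer $m>0$. *)

theory Defs
  imports Complex_Main
begin

text \<open>A VOA over Q is given by: a Q-vector space (carrier type 'v with scalar
multiplication sc), the products Y a n b  (= a_n b, n an integer), the vacuum vac,
the conformal vector om, and the grading subspaces grade n (= V_n).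
The axioms are the standard ones (Borcherds / Frenkel-Lepowsky-Meurman):
bilinearity, truncation, vacuum axioms, Borcherds identity, the Z-grading by
finite-dimensional subspaces bounded below, and the conformal vector axioms.\<close>

definition vacuum_axioms ::
  "('v::ab_group_add \<Rightarrow> int \<Rightarrow> 'v \<Rightarrow> 'v) \<Rightarrow> 'v \<Rightarrow> bool" where
  "vacuum_axioms Y vac \<longleftrightarrow>
     (\<forall>a n. Y vac n a = (if n = -1 then a else 0)) \<and>
     (\<forall>a. Y a (-1) vac = a) \<and>
     (\<forall>a n. n \<ge> 0 \<longrightarrow> Y a n vac = 0)"

text \<open>Borcherds identity, for all integers p q r:
  sum_{i>=0} (p choose i) (a_{r+i} b)_{p+q-i} c
   = sum_{i>=0} (-1)^i (r choose i) (a_{p+r-i} b_{q+i} c - (-1)^r b_{q+r-i} a_{p+i} c).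
Both sums are finite by truncation; we sum over i < M for any M beyond which all
the terms vanish.\<close>

definition borcherds_identity ::
  "(rat \<Rightarrow> 'v::ab_group_add \<Rightarrow> 'v) \<Rightarrow> ('v \<Rightarrow> int \<Rightarrow> 'v \<Rightarrow> 'v) \<Rightarrow> bool" where
  "borcherds_identity sc Y \<longleftrightarrow>
     (\<forall>a b c p q r M.
        (\<forall>i\<ge>M. Y a (r + int i) b = 0 \<and> Y b (q + int i) c = 0 \<and> Y a (p + int i) c = 0) \<longrightarrow>
        (\<Sum>i<M. sc (of_int p gchoose i) (Y (Y a (r + int i) b) (p + q - int i) c))
        = (\<Sum>i<M. sc ((-1) ^ i * (of_int r gchoose i))
              (Y a (p + r - int i) (Y b (q + int i) c)
               - sc (if even r then 1 else -1) (Y b (q + r - int i) (Y a (p + int i) c)))))"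

definition is_VOA ::
  "(rat \<Rightarrow> 'v::ab_group_add \<Rightarrow> 'v) \<Rightarrow> ('v \<Rightarrow> int \<Rightarrow> 'v \<Rightarrow> 'v) \<Rightarrow> 'v \<Rightarrow> 'v
    \<Rightarrow> (int \<Rightarrow> 'v set) \<Rightarrow> bool" where
  "is_VOA sc Y vac om grade \<longleftrightarrow>
     vector_space sc \<and>
     \<comment> \<open>bilinearity of all products\<close>
     (\<forall>a b c n. Y (a + b) n c = Y a n c + Y b n c \<and> Y a n (b + c) = Y a n b + Y a n c) \<and>
     (\<forall>q a b n. Y (sc q a) n b = sc q (Y a n b) \<and> Y a n (sc q b) = sc q (Y a n b)) \<and>
     \<comment> \<open>truncation\<close>
     (\<forall>a b. \<exists>N. \<forall>n\<ge>N. Y a n b = 0) \<and>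
     vacuum_axioms Y vac \<and>
     borcherds_identity sc Y \<and>
     \<comment> \<open>grading: V is the direct sum of the finite-dimensional subspaces V_n\<close>
     (\<forall>n. module.subspace sc (grade n)) \<and>
     (\<forall>n. \<exists>B. finite B \<and> B \<subseteq> grade n \<and> grade n \<subseteq> module.span sc B) \<and>
     (\<forall>v. \<exists>!f. finite {n. f n \<noteq> 0} \<and> (\<forall>n. f n \<in> grade n) \<and> v = sum f {n. f n \<noteq> 0}) \<and>
     (\<exists>N. \<forall>n<N. grade n = {0}) \<and>
     (\<forall>a b m n k. a \<in> grade m \<longrightarrow> b \<in> grade n \<longrightarrow> Y a k b \<in> grade (m + n - k - 1)) \<and>
     vac \<in> grade 0 \<and> om \<in> grade 2 \<and>
     \<comment> \<open>conformal vector: L(n) = om_{n+1}\<close>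
     (\<forall>n v. v \<in> grade n \<longrightarrow> Y om 1 v = sc (of_int n) v) \<and>
     (\<forall>a n b. Y (Y om 0 a) n b = sc (- of_int n) (Y a (n - 1) b)) \<and>
     (\<exists>c::rat. \<forall>m n v.
        Y om (m + 1) (Y om (n + 1) v) - Y om (n + 1) (Y om (m + 1) v)
        = sc (of_int (m - n)) (Y om (m + n + 1) v)
          + (if m + n = 0 then sc ((of_int m ^ 3 - of_int m) / 12 * c) v else 0))"

text \<open>The natural invariant bilinear form: bilinear, nondegenerate, normalised by
<vac,vac> = 1, and invariant:
  <Y(a,z)b, c> = <b, Y(e^{zL(1)}(-z^{-2})^{L(0)} a, z^{-1}) c>,
which in components, for a in V_k, reads
  <a_n b, c> = (-1)^k sum_{j>=0} (1/j!) <b, (L(1)^j a)_{2k-n-j-2} c>.\<close>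

definition natural_form ::
  "(rat \<Rightarrow> 'v::ab_group_add \<Rightarrow> 'v) \<Rightarrow> ('v \<Rightarrow> int \<Rightarrow> 'v \<Rightarrow> 'v) \<Rightarrow> 'v \<Rightarrow> 'v
    \<Rightarrow> (int \<Rightarrow> 'v set) \<Rightarrow> ('v \<Rightarrow> 'v \<Rightarrow> rat) \<Rightarrow> bool" where
  "natural_form sc Y vac om grade form \<longleftrightarrow>
     (\<forall>a b c. form (a + b) c = form a c + form b c \<and> form a (b + c) = form a b + form a c) \<and>
     (\<forall>q a b. form (sc q a) b = q * form a b \<and> form a (sc q b) = q * form a b) \<and>
     (\<forall>a. (\<forall>b. form a b = 0) \<longrightarrow> a = 0) \<and>
     (\<forall>b. (\<forall>a. form a b = 0) \<longrightarrow> b = 0) \<and>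
     form vac vac = 1 \<and>
     (\<forall>k a b c n M. a \<in> grade k \<longrightarrow> (\<forall>j\<ge>M. (Y om 2 ^^ j) a = 0) \<longrightarrow>
        form (Y a n b) c
        = (if even k then 1 else -1) *
          (\<Sum>j<M. form b (Y ((Y om 2 ^^ j) a) (2 * k - n - int j - 2) c) / fact j))"

definition VOA_aut ::
  "(rat \<Rightarrow> 'v::ab_group_add \<Rightarrow> 'v) \<Rightarrow> ('v \<Rightarrow> int \<Rightarrow> 'v \<Rightarrow> 'v) \<Rightarrow> 'v \<Rightarrow> 'v
    \<Rightarrow> ('v \<Rightarrow> 'v) \<Rightarrow> bool" where
  "VOA_aut sc Y vac om g \<longleftrightarrow>
     bij g \<and> (\<forall>a b. g (a + b) = g a + g b) \<and> (\<forall>q a. g (sc q a) = sc q (g a)) \<and>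
     (\<forall>a n b. g (Y a n b) = Y (g a) n (g b)) \<and> g vac = vac \<and> g om = om"

definition is_subgroup :: "('v \<Rightarrow> 'v) set \<Rightarrow> ('v \<Rightarrow> 'v) set \<Rightarrow> bool" where
  "is_subgroup H G \<longleftrightarrow> H \<subseteq> G \<and> id \<in> H \<and> (\<forall>g\<in>H. \<forall>h\<in>H. g \<circ> h \<in> H) \<and> (\<forall>g\<in>H. inv g \<in> H)"

definition finite_aut_group ::
  "(rat \<Rightarrow> 'v::ab_group_add \<Rightarrow> 'v) \<Rightarrow> ('v \<Rightarrow> int \<Rightarrow> 'v \<Rightarrow> 'v) \<Rightarrow> 'v \<Rightarrow> 'v
    \<Rightarrow> ('v \<Rightarrow> 'v) set \<Rightarrow> bool" where
  "finite_aut_group sc Y vac om G \<longleftrightarrow>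
     finite G \<and> is_subgroup G {g. VOA_aut sc Y vac om g}"

definition normal_subgroup :: "('v \<Rightarrow> 'v) set \<Rightarrow> ('v \<Rightarrow> 'v) set \<Rightarrow> bool" where
  "normal_subgroup E N \<longleftrightarrow> is_subgroup E N \<and> (\<forall>g\<in>N. \<forall>e\<in>E. g \<circ> e \<circ> inv g \<in> E)"

text \<open>E is isomorphic to (Z/2)^r; (Z/2)^r is modelled as the functions nat => bool
supported on {0..<r} with pointwise exclusive or.\<close>
definition iso_Z2_power :: "('v \<Rightarrow> 'v) set \<Rightarrow> nat \<Rightarrow> bool" where
  "iso_Z2_power E r \<longleftrightarrow>
     (\<exists>\<phi>. bij_betw \<phi> E {f :: nat \<Rightarrow> bool. \<forall>i\<ge>r. \<not> f i} \<and>
          (\<forall>e\<in>E. \<forall>e'\<in>E. \<phi> (e \<circ> e') = (\<lambda>i. \<phi> e i \<noteq> \<phi> e' i)))"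

definition linear_char :: "('v \<Rightarrow> 'v) set \<Rightarrow> (('v \<Rightarrow> 'v) \<Rightarrow> complex) \<Rightarrow> bool" where
  "linear_char E \<chi> \<longleftrightarrow> (\<forall>e\<in>E. \<chi> e \<noteq> 0) \<and> (\<forall>e\<in>E. \<forall>e'\<in>E. \<chi> (e \<circ> e') = \<chi> e * \<chi> e')"

definition nontrivial_char :: "('v \<Rightarrow> 'v) set \<Rightarrow> (('v \<Rightarrow> 'v) \<Rightarrow> complex) \<Rightarrow> bool" where
  "nontrivial_char E \<chi> \<longleftrightarrow> linear_char E \<chi> \<and> (\<exists>e\<in>E. \<chi> e \<noteq> 1)"

definition transitive_on_nontrivial_chars :: "('v \<Rightarrow> 'v) set \<Rightarrow> ('v \<Rightarrow> 'v) set \<Rightarrow> bool" where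
  "transitive_on_nontrivial_chars N E \<longleftrightarrow>
     (\<forall>\<chi> \<psi>. nontrivial_char E \<chi> \<longrightarrow> nontrivial_char E \<psi> \<longrightarrow>
        (\<exists>g\<in>N. \<forall>e\<in>E. \<psi> e = \<chi> (inv g \<circ> e \<circ> g)))"

definition fixed_points :: "('v \<Rightarrow> 'v) set \<Rightarrow> 'v set" where
  "fixed_points D = {v. \<forall>d\<in>D. d v = v}"

definition zspan :: "(rat \<Rightarrow> 'v::ab_group_add \<Rightarrow> 'v) \<Rightarrow> 'v set \<Rightarrow> 'v set" where
  "zspan sc B = {(\<Sum>b\<in>F. sc (of_int (c b)) b) | F c. finite F \<and> F \<subseteq> B}"

definition additive_subgroup :: "'v::ab_group_add set \<Rightarrow> bool" where
  "additive_subgroup A \<longleftrightarrow> 0 \<in> A \<and> (\<forall>a\<in>A. \<forall>b\<in>A. a + b \<in> A) \<and> (\<forall>a\<in>A. - a \<in> A)"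

definition product_closed :: "('v \<Rightarrow> int \<Rightarrow> 'v \<Rightarrow> 'v) \<Rightarrow> 'v set \<Rightarrow> bool" where
  "product_closed Y A \<longleftrightarrow> (\<forall>a\<in>A. \<forall>b\<in>A. \<forall>k. Y a k b \<in> A)"

definition integral_form ::
  "(rat \<Rightarrow> 'v::ab_group_add \<Rightarrow> 'v) \<Rightarrow> ('v \<Rightarrow> int \<Rightarrow> 'v \<Rightarrow> 'v) \<Rightarrow> 'v \<Rightarrow> 'v
    \<Rightarrow> 'v set \<Rightarrow> 'v set \<Rightarrow> bool" where
  "integral_form sc Y vac om S A \<longleftrightarrow>
     A \<subseteq> S \<and> additive_subgroup A \<and>
     (\<exists>B. \<not> module.dependent sc B \<and> module.span sc B = S \<and> A = zspan sc B) \<and>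
     product_closed Y A \<and>
     (\<exists>m::nat. m > 0 \<and> sc (of_nat m) vac \<in> A) \<and>
     (\<exists>m::nat. m > 0 \<and> sc (of_nat m) om \<in> A)"

definition generated_closure :: "('v::ab_group_add \<Rightarrow> int \<Rightarrow> 'v \<Rightarrow> 'v) \<Rightarrow> 'v set \<Rightarrow> 'v set" where
  "generated_closure Y F = \<Inter>{X. F \<subseteq> X \<and> additive_subgroup X \<and> product_closed Y X}"

definition finitely_generated :: "('v::ab_group_add \<Rightarrow> int \<Rightarrow> 'v \<Rightarrow> 'v) \<Rightarrow> 'v set \<Rightarrow> bool" where
  "finitely_generated Y A \<longleftrightarrow> (\<exists>F. finite F \<and> A = generated_closure Y F)"

definition lattice_integral :: "('v \<Rightarrow> 'v \<Rightarrow> rat) \<Rightarrow> 'v set \<Rightarrow> bool" where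
  "lattice_integral form A \<longleftrightarrow> (\<forall>a\<in>A. \<forall>b\<in>A. form a b \<in> \<int>)"

definition nearly_lattice_integral ::
  "(rat \<Rightarrow> 'v \<Rightarrow> 'v) \<Rightarrow> ('v \<Rightarrow> 'v \<Rightarrow> rat) \<Rightarrow> 'v set \<Rightarrow> bool" where
  "nearly_lattice_integral sc form A \<longleftrightarrow>
     (\<exists>m::nat. m > 0 \<and> lattice_integral form (sc (of_nat m) ` A))"

end

theory Submission
  imports Defs "HOL-Computational_Algebra.Group_Closure"
begin

text \<open>By transitivity on characters, \<open>V\<close> is spanned by the translates of \<open>W\<close> under \<open>N\<close>, so the
  translates of generators of \<open>K\<close> generate \<open>V\<close> as an algebra over the rationals. Replace them by
  positive multiples \<open>f\<close> of their homogeneous components such that \<open>L(1)\<^sup>j f / j!\<close> lies in \<open>J\<close> for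
  all \<open>j\<close>, add bases of \<open>J \<inter> \<rat>vac\<close> and \<open>J \<inter> \<rat>om\<close>, and close up under \<open>G\<close>. The subring
  \<open>J'\<close> generated by this finite set lies in \<open>J\<close> and spans \<open>V\<close>; it is an integral form because a
  subgroup of a free abelian group is free. Let \<open>L\<close> be the graded part of \<open>J\<close>. The adjoints of
  the generating modes preserve \<open>L\<close>, so \<open>J'\<close> acts on the dual lattice of \<open>L\<close>. This dual contains a
  positive multiple \<open>m vac\<close> of the vacuum, because \<open>vac\<close> pairs nontrivially only with the lattice
  \<open>J \<inter> V\<^sub>0\<close> of finite rank; hence it contains \<open>m J'\<close>, while \<open>J'\<close> itself lies in \<open>L\<close>.\<close>

section \<open>Additive subgroups of rational vector spaces\<close>

lemma additive_subgroup_diff: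
  "additive_subgroup A \<Longrightarrow> a \<in> A \<Longrightarrow> b \<in> A \<Longrightarrow> a - b \<in> A"
  unfolding additive_subgroup_def by (metis diff_conv_add_uminus)

lemma additive_subgroup_Int:
  "additive_subgroup A \<Longrightarrow> additive_subgroup B \<Longrightarrow> additive_subgroup (A \<inter> B)"
  by (simp add: additive_subgroup_def)

lemma additive_subgroup_INT:
  "(\<And>i. i \<in> I \<Longrightarrow> additive_subgroup (A i)) \<Longrightarrow> additive_subgroup (\<Inter>i\<in>I. A i)"
  by (simp add: additive_subgroup_def)

lemma additive_subgroup_vimage:
  assumes "module_hom s1 s2 f" "additive_subgroup H"
  shows "additive_subgroup (f -` H)"
proof -
  interpret module_hom s1 s2 f by fact
  show ?thesis using assms(2) by (simp add: additive_subgroup_def add neg)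
qed

lemma additive_subgroup_image:
  assumes "module_hom s1 s2 f" "additive_subgroup A"
  shows "additive_subgroup (f ` A)"
proof -
  interpret module_hom s1 s2 f by fact
  show ?thesis
    using assms(2) unfolding additive_subgroup_def
    by (auto simp flip: add neg intro: rev_image_eqI[of 0])
qed

lemma additive_subgroup_Ints: "additive_subgroup (\<int> :: 'a::ring_1 set)"
  by (simp add: additive_subgroup_def)

lemma additive_subgroup_int_principal:
  fixes H :: "int set"
  assumes "additive_subgroup H"
  shows "H = range ((*) (Gcd H))"
proof -
  have "h \<in> H" if "h \<in> group_closure H" for h
    using that assms
    by induction (auto intro: additive_subgroup_diff simp: additive_subgroup_def)
  then have "group_closure H = H" by (auto intro: group_closure.base)
  then show ?thesis using group_closure_eq by metis
qed

lemma rat_subgroup_of_Ints_cyclic: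
  fixes H :: "rat set"
  assumes H: "additive_subgroup H" "H \<subseteq> \<int>"
  obtains d where "d \<in> H" "H = range (\<lambda>k. of_int k * d)"
proof -
  define d where "d = Gcd {z. of_int z \<in> H}"
  have "additive_subgroup {z. of_int z \<in> H}"
    using H(1) by (simp add: additive_subgroup_def)
  then have "{z. of_int z \<in> H} = range ((*) d)"
    unfolding d_def by (rule additive_subgroup_int_principal)
  moreover have "H = of_int ` {z. of_int z \<in> H}"
    using H(2) by (auto elim!: Ints_cases)
  ultimately have "H = range (\<lambda>k. of_int k * of_int d)"
    by (auto simp: image_image mult.commute)
  moreover from this have "of_int d \<in> H" by (metis mult_1 of_int_1 rangeI)
  ultimately show thesis by (rule that[rotated])
qed

lemma rat_multiple_Ints:
  fixes q :: rat
  obtains m :: nat where "m > 0" "of_nat m * q \<in> \<int>"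
proof -
  obtain a b where q: "quotient_of q = (a, b)" "b > 0"
    by (metis surj_pair quotient_of_denom_pos)
  then have "of_nat (nat b) * q = of_int a" using quotient_of_div[of q a b] by simp
  then show thesis using that[of "nat b"] q(2) by simp
qed

locale rat_vector_space = vector_space sc
  for sc :: "rat \<Rightarrow> 'v::ab_group_add \<Rightarrow> 'v"
begin

sublocale int_module: module "\<lambda>k::int. sc (of_int k)"
  by unfold_locales (simp_all add: scale_right_distrib scale_left_distrib)

lemma int_subspace_iff: "int_module.subspace A \<longleftrightarrow> additive_subgroup A"
proof
  assume "int_module.subspace A"
  then show "additive_subgroup A"
    by (simp add: additive_subgroup_def int_module.subspace_0 int_module.subspace_add
        int_module.subspace_neg)
next
  assume A: "additive_subgroup A"
  have "sc (of_int k) a \<in> A" if a: "a \<in> A" for k a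
  proof (induction k rule: int_induct[of _ 0])
    case base
    then show ?case using A by (simp add: additive_subgroup_def)
  next
    case (step1 k)
    then show ?case using A a by (simp add: additive_subgroup_def scale_left_distrib)
  next
    case (step2 k)
    then show ?case using A a by (simp add: additive_subgroup_diff scale_left_diff_distrib)
  qed
  then show "int_module.subspace A"
    using A by (simp add: int_module.subspace_def additive_subgroup_def)
qed

lemma zspan_eq_int_span: "zspan sc S = int_module.span S"
  unfolding zspan_def int_module.span_explicit by auto

lemma additive_subgroup_scale_int: "additive_subgroup A \<Longrightarrow> a \<in> A \<Longrightarrow> sc (of_int k) a \<in> A"
  and additive_subgroup_sum: "additive_subgroup A \<Longrightarrow> (\<And>i. i \<in> I \<Longrightarrow> f i \<in> A) \<Longrightarrow> sum f I \<in> A"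
  unfolding int_subspace_iff[symmetric]
  by (fact int_module.subspace_scale int_module.subspace_sum)+

lemma additive_subgroup_zspan: "additive_subgroup (zspan sc S)"
  and zspan_superset: "S \<subseteq> zspan sc S"
  and zspan_base: "a \<in> S \<Longrightarrow> a \<in> zspan sc S"
  and zspan_zero: "0 \<in> zspan sc S"
  and zspan_add: "a \<in> zspan sc S \<Longrightarrow> b \<in> zspan sc S \<Longrightarrow> a + b \<in> zspan sc S"
  and zspan_scale: "a \<in> zspan sc S \<Longrightarrow> sc (of_int k) a \<in> zspan sc S"
  and zspan_minimal: "S \<subseteq> A \<Longrightarrow> additive_subgroup A \<Longrightarrow> zspan sc S \<subseteq> A"
  and zspan_mono: "S \<subseteq> S' \<Longrightarrow> zspan sc S \<subseteq> zspan sc S'"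
  unfolding zspan_eq_int_span int_subspace_iff[symmetric]
  by (fact int_module.subspace_span int_module.span_superset int_module.span_base
      int_module.span_zero int_module.span_add int_module.span_scale int_module.span_minimal
      int_module.span_mono)+

lemma subspace_imp_additive_subgroup: "subspace U \<Longrightarrow> additive_subgroup U"
  by (simp add: additive_subgroup_def subspace_0 subspace_add subspace_neg)

lemma additive_subgroup_span: "additive_subgroup (span S)"
  by (intro subspace_imp_additive_subgroup subspace_span)

lemma additive_subgroup_scale_Ints:
  "additive_subgroup A \<Longrightarrow> a \<in> A \<Longrightarrow> q \<in> \<int> \<Longrightarrow> sc q a \<in> A"
  by (auto elim!: Ints_cases intro: additive_subgroup_scale_int)

lemma zspan_subset_span: "zspan sc S \<subseteq> span S"
  by (intro zspan_minimal span_superset additive_subgroup_span)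

lemma span_zspan: "span (zspan sc S) = span S"
  by (meson span_eq zspan_subset_span zspan_superset span_superset order_trans)

lemma zspan_delete_zero: "zspan sc (S - {0}) = zspan sc S"
  by (intro subset_antisym zspan_mono zspan_minimal additive_subgroup_zspan)
    (auto intro: zspan_base zspan_zero)

lemma finite_subset_span_finite:
  assumes "finite T" "T \<subseteq> span S"
  obtains F where "finite F" "F \<subseteq> S" "T \<subseteq> span F"
proof -
  have "\<exists>F. finite F \<and> F \<subseteq> S \<and> T \<subseteq> span F"
    using assms
  proof (induction T rule: finite_induct)
    case (insert v T)
    then obtain F where F: "finite F" "F \<subseteq> S" "T \<subseteq> span F" by auto
    obtain t c where t: "finite t" "t \<subseteq> S" "v = (\<Sum>a\<in>t. sc (c a) a)"
      using insert.prems by (auto simp: span_explicit[of S])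
    have "v \<in> span t" unfolding t(3) by (intro span_sum span_scale span_base)
    then have "insert v T \<subseteq> span (F \<union> t)"
      using F(3) span_mono[of F "F \<union> t"] span_mono[of t "F \<union> t"] by auto
    then show ?case using F(1,2) t(1,2) by (intro exI[of _ "F \<union> t"]) simp
  qed auto
  then show thesis using that by blast
qed

lemma additive_subgroup_common_multiple:
  assumes A: "additive_subgroup A" and "finite X"
    and "\<And>x. x \<in> X \<Longrightarrow> \<exists>m::nat. m > 0 \<and> sc (of_nat m) x \<in> A"
  obtains m :: nat where "m > 0" "\<forall>x\<in>X. sc (of_nat m) x \<in> A"
proof -
  from assms(2,3) have "\<exists>m::nat. m > 0 \<and> (\<forall>x\<in>X. sc (of_nat m) x \<in> A)"
  proof (induction X rule: finite_induct)
    case empty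
    then show ?case by auto
  next
    case (insert y X)
    then obtain m n :: nat where m: "m > 0" "\<forall>x\<in>X. sc (of_nat m) x \<in> A"
      and n: "n > 0" "sc (of_nat n) y \<in> A" by blast
    have "sc (of_nat (n * m)) x \<in> A" if x: "x \<in> insert y X" for x
    proof (cases "x = y")
      case True
      have "sc (of_nat m) (sc (of_nat n) y) \<in> A"
        by (rule additive_subgroup_scale_Ints[OF A n(2)]) simp
      then show ?thesis using True by (simp add: mult.commute)
    next
      case False
      then have "sc (of_nat m) x \<in> A" using x m(2) by simp
      then have "sc (of_nat n) (sc (of_nat m) x) \<in> A"
        by (rule additive_subgroup_scale_Ints[OF A]) simp
      then show ?thesis by simp
    qed
    then show ?case using m(1) n(1) by (metis mult_pos_pos)
  qed
  then show thesis using that by blast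
qed

lemma span_multiple_in_zspan:
  assumes "v \<in> span S"
  shows "\<exists>m::nat. m > 0 \<and> sc (of_nat m) v \<in> zspan sc S"
  using assms
proof (induction rule: span_induct_alt)
  case base
  then show ?case using zspan_zero by auto
next
  case (step q x y)
  obtain m :: nat where "m > 0" "of_nat m * q \<in> \<int>" by (rule rat_multiple_Ints)
  then have "\<exists>m::nat. m > 0 \<and> sc (of_nat m) (sc q x) \<in> zspan sc S"
    using zspan_scale zspan_base[OF step(1)] by (auto elim!: Ints_cases intro!: exI[of _ m])
  with step(2) obtain m :: nat
    where m: "m > 0" "\<forall>z\<in>{sc q x, y}. sc (of_nat m) z \<in> zspan sc S"
    using additive_subgroup_common_multiple[OF additive_subgroup_zspan, of "{sc q x, y}" S] by blast
  have "sc (of_nat m) (sc q x + y) \<in> zspan sc S"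
    using m(2) zspan_add[of "sc (of_nat m) (sc q x)" S "sc (of_nat m) y"]
    by (simp add: scale_right_distrib)
  then show ?case using m(1) by blast
qed

lemma span_multiple_in_additive_subgroup:
  assumes "additive_subgroup A" "v \<in> span A"
  shows "\<exists>m::nat. m > 0 \<and> sc (of_nat m) v \<in> A"
  using span_multiple_in_zspan[OF assms(2)] zspan_minimal[OF order_refl assms(1)] by blast

lemma representation_hom:
  assumes "independent B" "span B = UNIV"
  shows "module_hom sc (*) (\<lambda>v. representation B v b)"
  using assms module_axioms
  by (auto simp: module_hom_iff representation_add representation_scale algebra_simps
      intro!: module.intro)

lemma representation_zspan_Ints:
  assumes "independent B" "v \<in> zspan sc B"
  shows "representation B v b \<in> \<int>"
proof -
  have "zspan sc B \<subseteq> {v \<in> span B. representation B v b \<in> \<int>}"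
    using assms(1)
    by (intro zspan_minimal)
      (auto simp: additive_subgroup_def span_base representation_basis span_zero
        representation_zero representation_add representation_neg span_add span_neg)
  then show ?thesis using assms(2) by blast
qed

lemma span_image_Union_chain:
  assumes v: "v \<in> span (f ` \<Union>\<X>)" and chain: "\<X> \<noteq> {}" "subset.chain \<A> \<X>"
  obtains X where "X \<in> \<X>" "v \<in> span (f ` X)"
proof -
  obtain F where F: "finite F" "F \<subseteq> f ` \<Union>\<X>" "v \<in> span F"
    using finite_subset_span_finite[of "{v}" "f ` \<Union>\<X>"] v by auto
  then obtain X' where X': "X' \<subseteq> \<Union>\<X>" "finite X'" "F = f ` X'"
    by (meson finite_subset_image)
  then obtain X where X: "X \<in> \<X>" "X' \<subseteq> X"
    using finite_subset_Union_chain[OF X'(2,1) chain] by blast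
  then have "v \<in> span (f ` X)" using F(3) X'(3) span_mono[of F "f ` X"] by blast
  then show thesis by (rule that[OF X(1)])
qed

lemma representation_kernel_span_insert:
  assumes B: "independent B" "span B = UNIV" and b: "b \<in> B" and F: "F \<subseteq> B - {b}"
  shows "{v \<in> span (insert b F). representation B v b = 0} = span F"
proof -
  interpret coord: module_hom sc "(*)" "\<lambda>v. representation B v b"
    by (rule representation_hom[OF B])
  have coord_zero: "representation B w b = 0" if "w \<in> span F" for w
  proof -
    have "F \<subseteq> {v. representation B v b = 0}"
      using F B(1) by (auto simp: representation_basis subset_iff)
    then show ?thesis using that span_minimal[OF _ coord.subspace_kernel] by blast
  qed
  moreover have "v \<in> span F" if v: "v \<in> span (insert b F)" "representation B v b = 0" for v
  proof -
    obtain k where k: "v - sc k b \<in> span F" using v(1) by (auto simp: span_breakdown_eq)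
    then have "k = 0"
      using coord_zero[OF k] v(2) B(1) b
      by (simp add: coord.diff coord.scale representation_basis)
    then show ?thesis using k by simp
  qed
  ultimately show ?thesis using span_mono[of F "insert b F"] by blast
qed

lemma zspan_insert_kernel_basis:
  assumes A: "additive_subgroup A" and \<phi>: "module_hom sc (*) \<phi>"
    and C: "{v \<in> A. \<phi> v = 0} = zspan sc C"
    and c: "c \<in> A" "\<phi> ` A \<subseteq> range (\<lambda>k. of_int k * \<phi> c)"
  shows "zspan sc (insert c C) = A"
proof
  have "C \<subseteq> A" using C zspan_superset by blast
  then show "zspan sc (insert c C) \<subseteq> A" using c(1) A by (intro zspan_minimal) simp_all
  interpret \<phi>: module_hom sc "(*)" \<phi> by fact
  show "A \<subseteq> zspan sc (insert c C)"
  proof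
    fix v assume v: "v \<in> A"
    then obtain k where k: "\<phi> v = of_int k * \<phi> c" using c(2) by blast
    have "v - sc (of_int k) c \<in> A"
      by (intro additive_subgroup_diff additive_subgroup_scale_int A v c(1))
    moreover have "\<phi> (v - sc (of_int k) c) = 0" using k by (simp add: \<phi>.diff \<phi>.scale)
    ultimately have "v - sc (of_int k) c \<in> zspan sc C" using C by blast
    then have "v - sc (of_int k) c \<in> zspan sc (insert c C)"
      using zspan_mono[of C "insert c C"] by blast
    moreover have "sc (of_int k) c \<in> zspan sc (insert c C)"
      by (intro zspan_scale zspan_base) simp
    ultimately have "(v - sc (of_int k) c) + sc (of_int k) c \<in> zspan sc (insert c C)"
      by (rule zspan_add)
    then show "v \<in> zspan sc (insert c C)" by simp
  qed
qed

text \<open>The exact sequence \<open>0 \<rightarrow> ker \<phi> \<rightarrow> A \<rightarrow> \<phi>(A) \<rightarrow> 0\<close> splits because \<open>\<phi>(A)\<close> is cyclic.\<close>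

lemma kernel_basis_extension:
  assumes A: "additive_subgroup A" and \<phi>: "module_hom sc (*) \<phi>" "\<phi> ` A \<subseteq> \<int>"
    and C: "independent C" "{v \<in> A. \<phi> v = 0} = zspan sc C"
  obtains c where "independent (insert c C - {0})" "A = zspan sc (insert c C)"
proof -
  interpret \<phi>: module_hom sc "(*)" \<phi> by fact
  obtain d where d: "d \<in> \<phi> ` A" "\<phi> ` A = range (\<lambda>k. of_int k * d)"
    using rat_subgroup_of_Ints_cyclic[OF additive_subgroup_image[OF \<phi>(1) A] \<phi>(2)] .
  obtain c where c: "c \<in> A" "\<phi> c = d" "d = 0 \<Longrightarrow> c = 0"
    using d(1) A by (cases "d = 0") (auto simp: additive_subgroup_def)
  have "A = zspan sc (insert c C)"
    using zspan_insert_kernel_basis[OF A \<phi>(1) C(2) c(1)] d(2) c(2) by simp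
  moreover have "independent (insert c C - {0})"
  proof (cases "d = 0")
    case True
    then show ?thesis using c(3) independent_mono[OF C(1), of "C - {0}"] by auto
  next
    case False
    have "C \<subseteq> {v. \<phi> v = 0}" using C(2) zspan_superset by blast
    then have "span C \<subseteq> {v. \<phi> v = 0}" using \<phi>.subspace_kernel by (rule span_minimal)
    then have "c \<notin> span C" using False c(2) by auto
    then have "independent (insert c C)" using C(1) by (simp add: independent_insert)
    then show ?thesis by (rule independent_mono) auto
  qed
  ultimately show thesis using that by blast
qed

text \<open>A pair \<open>(b, c)\<close> in \<open>X\<close> records the element \<open>c\<close> that the basis vector \<open>b\<close> contributes to a
  basis of \<open>A\<close>, with \<open>c = 0\<close> if it contributes none.\<close>

definition partial_basis :: "'v set \<Rightarrow> 'v set \<Rightarrow> ('v \<times> 'v) set \<Rightarrow> bool" where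
  "partial_basis A B X \<longleftrightarrow> fst ` X \<subseteq> B \<and> independent (snd ` X - {0}) \<and>
     A \<inter> span (fst ` X) = zspan sc (snd ` X)"

lemma partial_basis_Union_chain:
  assumes A: "additive_subgroup A"
    and chain: "\<X> \<noteq> {}" "subset.chain {X. partial_basis A B X} \<X>"
  shows "partial_basis A B (\<Union>\<X>)"
proof -
  have partial: "partial_basis A B X" if "X \<in> \<X>" for X
    using chain(2) that by (auto simp: subset.chain_def)
  have "independent (\<Union>X\<in>\<X>. snd ` X - {0})"
  proof (rule independent_Union_directed)
    fix C D assume "C \<in> (\<lambda>X. snd ` X - {0}) ` \<X>" "D \<in> (\<lambda>X. snd ` X - {0}) ` \<X>"
    then obtain X X' where X: "X \<in> \<X>" "C = snd ` X - {0}" "X' \<in> \<X>" "D = snd ` X' - {0}"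
      by blast
    then have "X \<subseteq> X' \<or> X' \<subseteq> X" using chain(2) by (auto simp: subset_chain_def)
    then show "C \<subseteq> D \<or> D \<subseteq> C" using X by blast
  qed (use partial in \<open>auto simp: partial_basis_def\<close>)
  moreover have "snd ` \<Union>\<X> - {0} = (\<Union>X\<in>\<X>. snd ` X - {0})" by blast
  moreover have "A \<inter> span (fst ` \<Union>\<X>) \<subseteq> zspan sc (snd ` \<Union>\<X>)"
  proof
    fix v assume v: "v \<in> A \<inter> span (fst ` \<Union>\<X>)"
    then obtain X where X: "X \<in> \<X>" "v \<in> span (fst ` X)"
      using span_image_Union_chain[OF _ chain] by blast
    then have "v \<in> A \<inter> span (fst ` X)" using v by simp
    also have "\<dots> = zspan sc (snd ` X)" using partial[OF X(1)] by (simp add: partial_basis_def)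
    also have "\<dots> \<subseteq> zspan sc (snd ` \<Union>\<X>)" using X(1) by (intro zspan_mono) blast
    finally show "v \<in> zspan sc (snd ` \<Union>\<X>)" .
  qed
  moreover have "snd ` \<Union>\<X> \<subseteq> A \<inter> span (fst ` \<Union>\<X>)"
  proof -
    have "snd ` X \<subseteq> A \<inter> span (fst ` \<Union>\<X>)" if "X \<in> \<X>" for X
      using partial[OF that] zspan_superset[of "snd ` X"] span_mono[of "fst ` X" "fst ` \<Union>\<X>"] that
      unfolding partial_basis_def by blast
    then show ?thesis by blast
  qed
  then have "zspan sc (snd ` \<Union>\<X>) \<subseteq> A \<inter> span (fst ` \<Union>\<X>)"
    using A by (intro zspan_minimal additive_subgroup_Int additive_subgroup_span)
  moreover have "fst ` X \<subseteq> B" if "X \<in> \<X>" for X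
    using partial[OF that] by (simp add: partial_basis_def)
  then have "fst ` \<Union>\<X> \<subseteq> B" by blast
  ultimately show ?thesis by (simp only: partial_basis_def subset_antisym simp_thms)
qed

lemma partial_basis_extend:
  assumes B: "independent B" "span B = UNIV" and A: "additive_subgroup A" "A \<subseteq> zspan sc B"
    and X: "partial_basis A B X" and b: "b \<in> B" "b \<notin> fst ` X"
  obtains c where "partial_basis A B (insert (b, c) X)"
proof -
  let ?A' = "A \<inter> span (insert b (fst ` X))"
  have "fst ` X \<subseteq> B - {b}" using X b(2) by (auto simp: partial_basis_def)
  then have "{v \<in> ?A'. representation B v b = 0} = A \<inter> span (fst ` X)"
    using representation_kernel_span_insert[OF B b(1)] by blast
  also have "\<dots> = zspan sc (snd ` X - {0})"
    using X by (simp add: partial_basis_def zspan_delete_zero)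
  finally have ker: "{v \<in> ?A'. representation B v b = 0} = zspan sc (snd ` X - {0})" .
  have "additive_subgroup ?A'"
    using A(1) by (intro additive_subgroup_Int additive_subgroup_span)
  moreover have "(\<lambda>v. representation B v b) ` ?A' \<subseteq> \<int>"
    using A(2) representation_zspan_Ints[OF B(1)] by blast
  moreover have "independent (snd ` X - {0})" using X by (simp add: partial_basis_def)
  ultimately obtain c where c: "independent (insert c (snd ` X - {0}) - {0})"
    "?A' = zspan sc (insert c (snd ` X - {0}))"
    using kernel_basis_extension[OF _ representation_hom[OF B] _ _ ker] by blast
  moreover have "insert c (snd ` X - {0}) - {0} = snd ` insert (b, c) X - {0}" by auto
  ultimately have "partial_basis A B (insert (b, c) X)"
    using X b(1) zspan_delete_zero[of "insert c (snd ` X - {0})"]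
      zspan_delete_zero[of "snd ` insert (b, c) X"]
    by (simp add: partial_basis_def)
  then show thesis by (rule that)
qed

theorem subgroup_of_free_is_free:
  assumes B: "independent B" and A: "additive_subgroup A" "A \<subseteq> zspan sc B"
  obtains C where "independent C" "A = zspan sc C"
proof -
  let ?B = "extend_basis B"
  have B': "independent ?B" "span ?B = UNIV" "A \<subseteq> zspan sc ?B"
    using A(2) zspan_mono[OF extend_basis_superset[OF B]] independent_extend_basis[OF B]
      span_extend_basis[OF B] by auto
  have "zspan sc {} = {0}" by (simp add: zspan_eq_int_span)
  then have "partial_basis A ?B {}"
    using A(1) independent_empty by (auto simp: partial_basis_def additive_subgroup_def)
  then have "{X. partial_basis A ?B X} \<noteq> {}" by blast
  moreover have "\<Union>\<X> \<in> {X. partial_basis A ?B X}"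
    if "\<X> \<noteq> {}" "subset.chain {X. partial_basis A ?B X} \<X>" for \<X>
    using partial_basis_Union_chain[OF A(1) that] by simp
  ultimately obtain X where X: "partial_basis A ?B X"
    and X_max: "\<And>X'. partial_basis A ?B X' \<Longrightarrow> X \<subseteq> X' \<Longrightarrow> X' = X"
    using subset_Zorn_nonempty[of "{X. partial_basis A ?B X}"] by (metis mem_Collect_eq)
  have "?B \<subseteq> fst ` X"
  proof
    fix b assume "b \<in> ?B"
    show "b \<in> fst ` X"
    proof (rule ccontr)
      assume "b \<notin> fst ` X"
      with \<open>b \<in> ?B\<close> obtain c where "partial_basis A ?B (insert (b, c) X)"
        using partial_basis_extend[OF B'(1,2) A(1) B'(3) X] by blast
      then have "(b, c) \<in> X" using X_max by blast
      with \<open>b \<notin> fst ` X\<close> show False by force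
    qed
  qed
  then have "span (fst ` X) = UNIV" using B'(2) span_mono by blast
  then show thesis
    using X that[of "snd ` X - {0}"] by (simp add: partial_basis_def zspan_delete_zero)
qed

corollary subgroup_of_free_finite_basis:
  assumes "independent B" "additive_subgroup A" "A \<subseteq> zspan sc B" "A \<subseteq> span T" "finite T"
  obtains C where "finite C" "A = zspan sc C"
proof -
  obtain C where C: "independent C" "A = zspan sc C"
    using subgroup_of_free_is_free[OF assms(1-3)] by blast
  moreover have "C \<subseteq> span T" using C(2) zspan_superset assms(4) by blast
  ultimately show thesis using that independent_span_bound[OF assms(5)] by blast
qed

end

section \<open>Linear groups of involutions\<close>

locale involution_group =
  fixes E :: "('v \<Rightarrow> 'v) set"
  assumes id_mem: "id \<in> E"
    and comp_mem: "\<And>e f. e \<in> E \<Longrightarrow> f \<in> E \<Longrightarrow> e \<circ> f \<in> E"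
    and involutive: "\<And>e. e \<in> E \<Longrightarrow> e \<circ> e = id"

lemma iso_Z2_power_involution_group:
  assumes E: "is_subgroup E N" and iso: "iso_Z2_power E r"
  shows "involution_group E"
proof
  show id: "id \<in> E" and comp: "\<And>e f. e \<in> E \<Longrightarrow> f \<in> E \<Longrightarrow> e \<circ> f \<in> E"
    using E by (auto simp: is_subgroup_def)
  fix e assume e: "e \<in> E"
  obtain \<phi> where bij: "bij_betw \<phi> E {f :: nat \<Rightarrow> bool. \<forall>i\<ge>r. \<not> f i}"
    and hom: "\<forall>e\<in>E. \<forall>f\<in>E. \<phi> (e \<circ> f) = (\<lambda>i. \<phi> e i \<noteq> \<phi> f i)"
    using iso unfolding iso_Z2_power_def by (elim exE conjE)
  have "\<phi> (e \<circ> e) = (\<lambda>i. False)" by (subst hom[rule_format, OF e e]) simp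
  also have "\<dots> = \<phi> (id \<circ> id)" by (subst hom[rule_format, OF id id]) simp
  finally show "e \<circ> e = id"
    using bij_betw_imp_inj_on[OF bij] id comp[OF e e] by (auto dest: inj_onD)
qed

context involution_group
begin

lemma involutive_apply: "e \<in> E \<Longrightarrow> e (e v) = v"
  using involutive by (metis comp_apply id_apply)

lemma commute_apply:
  assumes "e \<in> E" "f \<in> E"
  shows "e (f v) = f (e v)"
  using involutive_apply[OF comp_mem[OF assms], of "f (e v)"] involutive_apply assms
  by (metis comp_apply)

lemma comp_cancel: "e \<in> E \<Longrightarrow> e \<circ> (e \<circ> f) = f"
  by (simp add: fun_eq_iff involutive_apply)

lemma comp_left_commute: "e \<in> E \<Longrightarrow> f \<in> E \<Longrightarrow> e \<circ> (f \<circ> g) = f \<circ> (e \<circ> g)"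
  by (simp add: fun_eq_iff commute_apply)

lemma inv_eq_self: "e \<in> E \<Longrightarrow> inv e = e"
  by (intro inv_unique_comp involutive)

lemma is_subgroup_iff:
  "is_subgroup M E \<longleftrightarrow> M \<subseteq> E \<and> id \<in> M \<and> (\<forall>g\<in>M. \<forall>h\<in>M. g \<circ> h \<in> M)"
  unfolding is_subgroup_def by (metis inv_eq_self subsetD)

lemma is_subgroup_adjoin:
  assumes M: "is_subgroup M E" and e: "e \<in> E"
  shows "is_subgroup {g \<in> E. g \<in> M \<or> e \<circ> g \<in> M} E"
proof -
  have ME: "M \<subseteq> E" and id: "id \<in> M" and comp: "\<And>g h. g \<in> M \<Longrightarrow> h \<in> M \<Longrightarrow> g \<circ> h \<in> M"
    using M by (auto simp: is_subgroup_iff)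
  have "g \<circ> h \<in> M \<or> e \<circ> (g \<circ> h) \<in> M"
    if "g \<in> E" "h \<in> E" "g \<in> M \<or> e \<circ> g \<in> M" "h \<in> M \<or> e \<circ> h \<in> M" for g h
  proof -
    have "(e \<circ> g) \<circ> h = e \<circ> (g \<circ> h)" by (rule comp_assoc)
    moreover have "g \<circ> (e \<circ> h) = e \<circ> (g \<circ> h)" by (rule comp_left_commute[OF that(1) e])
    moreover have "(e \<circ> g) \<circ> (e \<circ> h) = g \<circ> h"
      using that(1) e by (simp add: comp_assoc comp_left_commute[of g e] comp_cancel)
    ultimately show ?thesis using that(3,4) comp by metis
  qed
  then show ?thesis using id comp_mem id_mem by (simp add: is_subgroup_iff)
qed

text \<open>A subgroup that is maximal among those avoiding a given element has index two, because all
  elements are involutions.\<close>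

lemma index_two_subgroup_exists:
  assumes "finite E" and D: "is_subgroup D E" "D \<noteq> E"
  obtains M where "is_subgroup M E" "D \<subseteq> M" "M \<noteq> E"
    "\<forall>e\<in>E - M. \<forall>f\<in>E - M. e \<circ> f \<in> M"
proof -
  obtain a where a: "a \<in> E" "a \<notin> D" using D by (auto simp: is_subgroup_def)
  define \<M> where "\<M> = {M. is_subgroup M E \<and> D \<subseteq> M \<and> a \<notin> M}"
  have "finite \<M>"
    using \<open>finite E\<close> by (rule finite_subset[rotated, OF finite_Pow_iff[THEN iffD2]])
      (auto simp: \<M>_def is_subgroup_def)
  moreover have "D \<in> \<M>" using D a by (simp add: \<M>_def)
  ultimately obtain M where "M \<in> \<M>" and max: "\<And>M'. M' \<in> \<M> \<Longrightarrow> M \<subseteq> M' \<Longrightarrow> M' = M"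
    using finite_has_maximal[of \<M>] by blast
  then have M: "is_subgroup M E" "D \<subseteq> M" "a \<notin> M" by (auto simp: \<M>_def)
  have coset: "e \<circ> a \<in> M" if e: "e \<in> E - M" for e
  proof -
    let ?M' = "{g \<in> E. g \<in> M \<or> e \<circ> g \<in> M}"
    have "e \<in> ?M'" using M(1) e involutive[of e] by (simp add: is_subgroup_iff)
    then have "?M' \<noteq> M" using e by auto
    moreover have "M \<subseteq> ?M'" using M(1) by (auto simp: is_subgroup_iff)
    moreover have "is_subgroup ?M' E" using is_subgroup_adjoin[OF M(1)] e by simp
    ultimately have "a \<in> ?M'" using max[of ?M'] M(2) unfolding \<M>_def by auto
    then show ?thesis using M(3) by simp
  qed
  have "e \<circ> f \<in> M" if e: "e \<in> E - M" and f: "f \<in> E - M" for e f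
  proof -
    have "(e \<circ> a) \<circ> (f \<circ> a) = e \<circ> f"
      using e f a(1) by (simp add: fun_eq_iff commute_apply[of f a] involutive_apply)
    moreover have "(e \<circ> a) \<circ> (f \<circ> a) \<in> M"
      using coset[OF e] coset[OF f] M(1) by (simp add: is_subgroup_iff)
    ultimately show ?thesis by simp
  qed
  moreover have "M \<noteq> E" using M(3) a(1) by auto
  ultimately show thesis using that M(1,2) by simp
qed

lemma separating_character:
  assumes "finite E" and D: "is_subgroup D E" "D \<noteq> E"
  obtains \<chi> where "nontrivial_char E \<chi>" "\<And>d. d \<in> D \<Longrightarrow> \<chi> d = 1"
proof -
  obtain M where M: "is_subgroup M E" "D \<subseteq> M" "M \<noteq> E"
    and index_two: "\<forall>e\<in>E - M. \<forall>f\<in>E - M. e \<circ> f \<in> M"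
    by (rule index_two_subgroup_exists[OF assms])
  have mixed: "e \<circ> f \<notin> M" "f \<circ> e \<notin> M" if "e \<in> M" "f \<in> E - M" for e f
  proof -
    have e: "e \<in> E" using M(1) that(1) by (auto simp: is_subgroup_iff)
    have "f = e \<circ> (e \<circ> f)" by (rule comp_cancel[OF e, symmetric])
    then show "e \<circ> f \<notin> M" using that M(1) by (metis DiffD2 is_subgroup_iff)
    then show "f \<circ> e \<notin> M" using comp_left_commute[of f e id] e that(2) by simp
  qed
  define \<chi> :: "('v \<Rightarrow> 'v) \<Rightarrow> complex" where "\<chi> e = (if e \<in> M then 1 else -1)" for e
  have "\<chi> (e \<circ> f) = \<chi> e * \<chi> f" if "e \<in> E" "f \<in> E" for e f
    using that index_two mixed M(1) by (auto simp: \<chi>_def is_subgroup_def)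
  moreover have "\<exists>e\<in>E. \<chi> e \<noteq> 1" using M(1,3) by (auto simp: \<chi>_def is_subgroup_def)
  moreover have "\<chi> e \<noteq> 0" for e by (simp add: \<chi>_def)
  ultimately have "nontrivial_char E \<chi>"
    by (simp add: nontrivial_char_def linear_char_def)
  moreover have "\<chi> d = 1" if "d \<in> D" for d using that M(2) by (auto simp: \<chi>_def)
  ultimately show thesis by (rule that)
qed

end

definition sign_eigenvectors :: "('v::ab_group_add \<Rightarrow> 'v) set \<Rightarrow> 'v set" where
  "sign_eigenvectors S = {u. \<forall>e\<in>S. e u = u \<or> e u = - u}"

definition eigen_character :: "'v \<Rightarrow> ('v \<Rightarrow> 'v) \<Rightarrow> complex" where
  "eigen_character u e = (if e u = u then 1 else -1)"

context rat_vector_space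
begin

lemma sign_eigenvector_split:
  assumes hom: "\<And>f. f \<in> insert e S \<Longrightarrow> module_hom sc sc f"
    and e: "\<And>v. e (e v) = v" and commute: "\<And>f v. f \<in> S \<Longrightarrow> f (e v) = e (f v)"
    and u: "u \<in> sign_eigenvectors S"
  shows "u + e u \<in> sign_eigenvectors (insert e S)" "u - e u \<in> sign_eigenvectors (insert e S)"
proof -
  interpret e: module_hom sc sc e using hom by simp
  have "f (u + e u) = u + e u \<or> f (u + e u) = - (u + e u)"
    "f (u - e u) = u - e u \<or> f (u - e u) = - (u - e u)" if f: "f \<in> S" for f
  proof -
    interpret f: module_hom sc sc f using hom f by simp
    have "f u = u \<or> f u = - u" using u f by (simp add: sign_eigenvectors_def)
    then show "f (u + e u) = u + e u \<or> f (u + e u) = - (u + e u)"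
      "f (u - e u) = u - e u \<or> f (u - e u) = - (u - e u)"
      by (auto simp: f.add f.diff commute[OF f] e.neg)
  qed
  then show "u + e u \<in> sign_eigenvectors (insert e S)" "u - e u \<in> sign_eigenvectors (insert e S)"
    by (simp_all add: sign_eigenvectors_def e.add e.diff e)
qed

lemma span_sign_eigenvectors:
  assumes "finite S"
    and "\<And>e. e \<in> S \<Longrightarrow> module_hom sc sc e"
    and "\<And>e v. e \<in> S \<Longrightarrow> e (e v) = v"
    and "\<And>e f v. e \<in> S \<Longrightarrow> f \<in> S \<Longrightarrow> e (f v) = f (e v)"
  shows "span (sign_eigenvectors S) = UNIV"
  using assms
proof (induction S rule: finite_induct)
  case empty
  then show ?case by (simp add: sign_eigenvectors_def)
next
  case (insert e S)
  have "u \<in> span (sign_eigenvectors (insert e S))" if u: "u \<in> sign_eigenvectors S" for u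
  proof -
    have "u + e u \<in> sign_eigenvectors (insert e S)" "u - e u \<in> sign_eigenvectors (insert e S)"
      using sign_eigenvector_split[OF _ _ _ u, of e] insert.prems by auto
    then have "sc (1/2) ((u + e u) + (u - e u)) \<in> span (sign_eigenvectors (insert e S))"
      by (intro span_scale span_add span_base)
    moreover have "(u + e u) + (u - e u) = sc 2 u"
      using scale_left_distrib[of 1 1 u] by simp
    ultimately show ?thesis by simp
  qed
  then have "span (sign_eigenvectors S) \<subseteq> span (sign_eigenvectors (insert e S))"
    by (intro span_minimal) auto
  moreover have "span (sign_eigenvectors S) = UNIV" using insert by simp
  ultimately show ?case by auto
qed

lemma nontrivial_eigen_character:
  assumes hom: "\<And>e. e \<in> E \<Longrightarrow> module_hom sc sc e"
    and u: "u \<in> sign_eigenvectors E" "u \<notin> fixed_points E"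
  shows "nontrivial_char E (eigen_character u)"
proof -
  have "u \<noteq> - u" using u by (auto simp: sign_eigenvectors_def fixed_points_def)
  have "eigen_character u (e \<circ> f) = eigen_character u e * eigen_character u f"
    if "e \<in> E" "f \<in> E" for e f
  proof -
    have "e u = u \<or> e u = - u" "f u = u \<or> f u = - u"
      using u(1) that by (auto simp: sign_eigenvectors_def)
    moreover have "e (- u) = - e u" using module_hom.neg[OF hom[OF that(1)]] .
    ultimately show ?thesis using \<open>u \<noteq> - u\<close> by (auto simp: eigen_character_def)
  qed
  then show ?thesis
    using u(2) by (auto simp: nontrivial_char_def linear_char_def eigen_character_def
        fixed_points_def)
qed

lemma sign_eigenvector_in_translate:
  assumes EN: "normal_subgroup E N" and bij: "\<And>g. g \<in> N \<Longrightarrow> bij g"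
    and hom: "\<And>e. e \<in> E \<Longrightarrow> module_hom sc sc e"
    and trans: "transitive_on_nontrivial_chars N E"
    and D: "D \<subseteq> E" and \<chi>: "nontrivial_char E \<chi>" "\<And>d. d \<in> D \<Longrightarrow> \<chi> d = 1"
    and u: "u \<in> sign_eigenvectors E" "u \<notin> fixed_points E"
  obtains g where "g \<in> N" "u \<in> g ` fixed_points D"
proof -
  obtain g where g: "g \<in> N" "\<And>e. e \<in> E \<Longrightarrow> eigen_character u e = \<chi> (inv g \<circ> e \<circ> g)"
    using trans \<chi>(1) nontrivial_eigen_character[OF hom u]
    unfolding transitive_on_nontrivial_chars_def by blast
  have inv: "inv g (g x) = x" "g (inv g x) = x" for x
    using bij[OF g(1)] by (simp_all add: bij_is_inj bij_is_surj surj_f_inv_f)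
  have "d (inv g u) = inv g u" if d: "d \<in> D" for d
  proof -
    have "g \<circ> d \<circ> inv g \<in> E" using EN g(1) d D by (auto simp: normal_subgroup_def)
    moreover have "inv g \<circ> (g \<circ> d \<circ> inv g) \<circ> g = d" using inv by auto
    ultimately have "eigen_character u (g \<circ> d \<circ> inv g) = 1" using g(2) \<chi>(2)[OF d] by simp
    then have "g (d (inv g u)) = u" by (simp add: eigen_character_def split: if_splits)
    then show ?thesis using inv by metis
  qed
  then have "inv g u \<in> fixed_points D" by (simp add: fixed_points_def)
  then have "u \<in> g ` fixed_points D" using inv(2) by (metis imageI)
  then show thesis by (rule that[OF g(1)])
qed

lemma span_translates_of_fixed_points:
  assumes E: "involution_group E" "finite E" and EN: "normal_subgroup E N"
    and bij: "\<And>g. g \<in> N \<Longrightarrow> bij g"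
    and hom: "\<And>e. e \<in> E \<Longrightarrow> module_hom sc sc e"
    and trans: "transitive_on_nontrivial_chars N E"
    and D: "is_subgroup D E" "D \<noteq> E"
  shows "span (\<Union>g\<in>N. g ` fixed_points D) = UNIV"
proof -
  interpret involution_group E by (rule E)
  have DE: "D \<subseteq> E" and id: "id \<in> N"
    using D EN by (auto simp: normal_subgroup_def is_subgroup_def)
  obtain \<chi> where \<chi>: "nontrivial_char E \<chi>" "\<And>d. d \<in> D \<Longrightarrow> \<chi> d = 1"
    by (rule separating_character[OF E(2) D]) blast
  have "u \<in> (\<Union>g\<in>N. g ` fixed_points D)" if u: "u \<in> sign_eigenvectors E" for u
  proof (cases "u \<in> fixed_points E")
    case True
    then have "u \<in> id ` fixed_points D" using DE by (auto simp: fixed_points_def)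
    then show ?thesis using id by blast
  next
    case False
    then show ?thesis
      using sign_eigenvector_in_translate[OF EN bij hom trans DE \<chi> u] by blast
  qed
  then have "span (sign_eigenvectors E) \<subseteq> span (\<Union>g\<in>N. g ` fixed_points D)"
    by (intro span_mono) blast
  moreover have "span (sign_eigenvectors E) = UNIV"
    by (intro span_sign_eigenvectors E(2) hom involutive_apply commute_apply)
  ultimately show ?thesis by auto
qed

end

section \<open>Vertex operator algebras over the rationals\<close>

lemma generated_closure_superset: "F \<subseteq> generated_closure Y F"
  by (auto simp: generated_closure_def)

lemma additive_subgroup_generated_closure: "additive_subgroup (generated_closure Y F)"
  by (auto simp: generated_closure_def additive_subgroup_def)

lemma product_closed_generated_closure: "product_closed Y (generated_closure Y F)"
  by (auto simp: generated_closure_def product_closed_def)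

lemma generated_closure_minimal:
  "F \<subseteq> X \<Longrightarrow> additive_subgroup X \<Longrightarrow> product_closed Y X \<Longrightarrow> generated_closure Y F \<subseteq> X"
  by (auto simp: generated_closure_def)

locale voa =
  fixes sc :: "rat \<Rightarrow> 'v::ab_group_add \<Rightarrow> 'v"
    and Y :: "'v \<Rightarrow> int \<Rightarrow> 'v \<Rightarrow> 'v"
    and vac om :: 'v
    and grade :: "int \<Rightarrow> 'v set"
  assumes VOA: "is_VOA sc Y vac om grade"

sublocale voa \<subseteq> rat_vector_space sc
  using VOA unfolding is_VOA_def rat_vector_space_def by blast

context voa
begin

abbreviation L1 :: "'v \<Rightarrow> 'v" where "L1 \<equiv> Y om 2"

lemma Y_left_hom: "module_hom sc sc (\<lambda>a. Y a n b)"
  and Y_right_hom: "module_hom sc sc (Y a n)"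
  using VOA module_axioms unfolding is_VOA_def module_hom_iff by (elim conjE; simp)+

sublocale Y_left: module_hom sc sc "\<lambda>a. Y a n b" for n b
  by (rule Y_left_hom)

sublocale Y_right: module_hom sc sc "Y a n" for a n
  by (rule Y_right_hom)

lemma Y_truncation: "\<exists>N. \<forall>n\<ge>N. Y a n b = 0"
  and Y_vac_right: "Y a (-1) vac = a"
  and Y_vac_right_nonneg: "n \<ge> 0 \<Longrightarrow> Y a n vac = 0"
  and borcherds: "borcherds_identity sc Y"
  and Y_grade: "a \<in> grade k \<Longrightarrow> b \<in> grade l \<Longrightarrow> Y a n b \<in> grade (k + l - n - 1)"
  and L0_grade: "v \<in> grade k \<Longrightarrow> Y om 1 v = sc (of_int k) v"
  using VOA unfolding is_VOA_def vacuum_axioms_def by (elim conjE; simp)+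

lemma subspace_grade: "subspace (grade n)"
  and grade_finite_dim: "\<exists>B. finite B \<and> B \<subseteq> grade n \<and> grade n \<subseteq> span B"
  and grade_decomposition:
    "\<exists>!f. finite {n. f n \<noteq> 0} \<and> (\<forall>n. f n \<in> grade n) \<and> v = sum f {n. f n \<noteq> 0}"
  and grade_bounded_below: "\<exists>N. \<forall>n<N. grade n = {0}"
  and vac_grade: "vac \<in> grade 0"
  and om_grade: "om \<in> grade 2"
  using VOA unfolding is_VOA_def by (elim conjE; simp)+

lemma L1_vac: "L1 vac = 0"
  by (simp add: Y_vac_right_nonneg)

lemma L1_om: "L1 om = 0"
proof -
  obtain c :: rat where virasoro: "\<forall>m n v.
        Y om (m + 1) (Y om (n + 1) v) - Y om (n + 1) (Y om (m + 1) v)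
        = sc (of_int (m - n)) (Y om (m + n + 1) v)
          + (if m + n = 0 then sc ((of_int m ^ 3 - of_int m) / 12 * c) v else 0)"
    using VOA unfolding is_VOA_def by (elim conjE exE)
  show ?thesis
    using virasoro[rule_format, of 1 "-2" vac] by (simp add: Y_vac_right Y_vac_right_nonneg)
qed

lemma L1_pow_hom: "module_hom sc sc (L1 ^^ j)"
proof (induction j)
  case 0
  show ?case unfolding funpow.simps(1) by (rule module.module_hom_id[OF module_axioms])
next
  case (Suc j)
  then show ?case unfolding funpow.simps(2) by (rule module_hom_compose) (rule Y_right_hom)
qed

sublocale L1_pow: module_hom sc sc "L1 ^^ j" for j
  by (rule L1_pow_hom)

lemma L1_pow_grade: "a \<in> grade k \<Longrightarrow> (L1 ^^ j) a \<in> grade (k - int j)"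
proof (induction j)
  case (Suc j)
  show ?case using Y_grade[OF om_grade Suc.IH[OF Suc.prems], of 2] by (simp add: algebra_simps)
qed simp

lemma L1_nilpotent:
  assumes "a \<in> grade k"
  obtains M where "\<And>j. j \<ge> M \<Longrightarrow> (L1 ^^ j) a = 0"
proof -
  obtain N where N: "\<And>n. n < N \<Longrightarrow> grade n = {0}" using grade_bounded_below by blast
  have "(L1 ^^ j) a = 0" if "j \<ge> nat (k - N + 1)" for j
    using L1_pow_grade[OF assms, of j] N[of "k - int j"] that by auto
  then show thesis by (rule that)
qed

definition homogeneous :: "'v set" where
  "homogeneous = (\<Union>k. grade k)"

lemma homogeneous_decomposition:
  obtains S f where "finite S" "\<And>n. f n \<in> grade n" "v = (\<Sum>n\<in>S. f n)"
  using grade_decomposition[of v] by blast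

lemma span_homogeneous: "span homogeneous = UNIV"
proof -
  have "v \<in> span homogeneous" for v
  proof -
    obtain S f where f: "finite S" "\<And>n. f n \<in> grade n" "v = (\<Sum>n\<in>S. f n)"
      using homogeneous_decomposition[of v] by blast
    have "f n \<in> homogeneous" for n using f(2) by (auto simp: homogeneous_def)
    then show ?thesis unfolding f(3) by (intro span_sum span_base)
  qed
  then show ?thesis by blast
qed

lemma homogeneous_sum_zero:
  assumes "finite S" "\<And>n. n \<in> S \<Longrightarrow> f n \<in> grade n" "sum f S = 0" "n \<in> S"
  shows "f n = 0"
proof -
  define decomposes where
    "decomposes h \<longleftrightarrow> finite {n. h n \<noteq> 0} \<and> (\<forall>n. h n \<in> grade n) \<and> 0 = sum h {n. h n \<noteq> 0}" for h
  define f' where "f' n = (if n \<in> S then f n else 0)" for n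
  have supp: "{n. f' n \<noteq> 0} \<subseteq> S" by (auto simp: f'_def)
  have "sum f' {n. f' n \<noteq> 0} = sum f' S"
    using supp assms(1) by (intro sum.mono_neutral_left) auto
  also have "\<dots> = 0" using assms(3) by (simp add: f'_def)
  finally have "decomposes f'"
    using assms(1,2) finite_subset[OF supp] subspace_0[OF subspace_grade]
    by (simp add: decomposes_def f'_def)
  moreover have "decomposes (\<lambda>_. 0)"
    using subspace_0[OF subspace_grade] by (simp add: decomposes_def)
  ultimately have "f' = (\<lambda>_. 0)"
    using grade_decomposition[of 0, folded decomposes_def] by blast
  then show ?thesis using assms(4) unfolding f'_def by metis
qed

lemma L0_eigenspace:
  assumes "Y om 1 v = sc (of_int k) v"
  shows "v \<in> grade k"
proof -
  obtain S f where f: "finite S" "\<And>n. f n \<in> grade n" "v = (\<Sum>n\<in>S. f n)"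
    using homogeneous_decomposition[of v] by blast
  have "0 = Y om 1 v - sc (of_int k) v" using assms by simp
  also have "\<dots> = (\<Sum>n\<in>S. sc (of_int (n - k)) (f n))"
    by (simp add: f(3) Y_right.sum L0_grade[OF f(2)] scale_sum_right scale_left_diff_distrib
        sum_subtractf)
  finally have "sc (of_int (n - k)) (f n) = 0" if "n \<in> S" for n
    using homogeneous_sum_zero[OF f(1), of "\<lambda>n. sc (of_int (n - k)) (f n)" n] that f(2)
    by (simp add: subspace_scale[OF subspace_grade])
  then have "n = k \<or> f n = 0" if "n \<in> S" for n using that by fastforce
  then have "f n \<in> grade k" if "n \<in> S" for n
    using that f(2)[of n] subspace_0[OF subspace_grade, of k] by metis
  then show ?thesis unfolding f(3) by (intro subspace_sum[OF subspace_grade])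
qed

lemma VOA_aut_hom: "VOA_aut sc Y vac om g \<Longrightarrow> module_hom sc sc g"
  using module_axioms by (simp add: VOA_aut_def module_hom_iff)

lemma VOA_aut_grade: "VOA_aut sc Y vac om g \<Longrightarrow> v \<in> grade k \<Longrightarrow> g v \<in> grade k"
  unfolding VOA_aut_def by (intro L0_eigenspace) (metis L0_grade)

lemma VOA_aut_L1_pow: "VOA_aut sc Y vac om g \<Longrightarrow> g ((L1 ^^ j) a) = (L1 ^^ j) (g a)"
  unfolding VOA_aut_def by (induction j) auto

lemma finite_aut_group_finite: "finite_aut_group sc Y vac om G \<Longrightarrow> finite G"
  and finite_aut_group_id: "finite_aut_group sc Y vac om G \<Longrightarrow> id \<in> G"
  and finite_aut_group_comp:
    "finite_aut_group sc Y vac om G \<Longrightarrow> g \<in> G \<Longrightarrow> h \<in> G \<Longrightarrow> g \<circ> h \<in> G"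
  and finite_aut_group_VOA_aut: "finite_aut_group sc Y vac om G \<Longrightarrow> g \<in> G \<Longrightarrow> VOA_aut sc Y vac om g"
  by (auto simp: finite_aut_group_def is_subgroup_def)

lemma finite_aut_group_trivial: "finite_aut_group sc Y vac om {id}"
  by (auto simp: finite_aut_group_def is_subgroup_def VOA_aut_def)

lemma VOA_aut_generated_closure:
  assumes g: "VOA_aut sc Y vac om g" and X: "additive_subgroup X" "product_closed Y X"
    and F: "g ` F \<subseteq> X"
  shows "g ` generated_closure Y F \<subseteq> X"
proof -
  have "product_closed Y (g -` X)" using X(2) g by (simp add: product_closed_def VOA_aut_def)
  then have "generated_closure Y F \<subseteq> g -` X"
    using F by (intro generated_closure_minimal
        additive_subgroup_vimage[OF VOA_aut_hom[OF g] X(1)]) auto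
  then show ?thesis by blast
qed

lemma product_closed_zspan:
  assumes "\<And>a b k. a \<in> S \<Longrightarrow> b \<in> S \<Longrightarrow> Y a k b \<in> zspan sc S"
  shows "product_closed Y (zspan sc S)"
proof -
  have "zspan sc S \<subseteq> Y a k -` zspan sc S" if "a \<in> S" for a k
    using assms that
    by (intro zspan_minimal additive_subgroup_vimage[OF Y_right_hom] additive_subgroup_zspan) auto
  then have "zspan sc S \<subseteq> (\<lambda>a. Y a k b) -` zspan sc S" if "b \<in> zspan sc S" for b k
    using that
    by (intro zspan_minimal additive_subgroup_vimage[OF Y_left_hom] additive_subgroup_zspan) auto
  then show ?thesis unfolding product_closed_def by blast
qed

lemma product_closed_span:
  assumes "product_closed Y A"
  shows "product_closed Y (span A)"
proof -
  have "span A \<subseteq> Y a k -` span A" if "a \<in> A" for a k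
    using assms that
    by (intro span_minimal Y_right.subspace_vimage subspace_span)
      (auto simp: product_closed_def intro!: span_base)
  then have "span A \<subseteq> (\<lambda>a. Y a k b) -` span A" if "b \<in> span A" for b k
    using that by (intro span_minimal Y_left.subspace_vimage subspace_span) auto
  then show ?thesis unfolding product_closed_def by blast
qed

lemma Y_iterate_expansion:
  fixes k q :: int
  obtains M where "Y (Y a k b) q c =
    (\<Sum>i<M. sc ((-1) ^ i * (of_int k gchoose i))
      (Y a (k - int i) (Y b (q + int i) c) -
       sc (if even k then 1 else -1) (Y b (q + k - int i) (Y a (int i) c))))"
proof -
  obtain N1 N2 N3 where N: "\<forall>n\<ge>N1. Y a n b = 0" "\<forall>n\<ge>N2. Y b n c = 0" "\<forall>n\<ge>N3. Y a n c = 0"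
    using Y_truncation by meson
  define M where "M = Suc (nat (max (N1 - k) (max (N2 - q) N3)))"
  have "\<forall>i\<ge>M. Y a (k + int i) b = 0 \<and> Y b (q + int i) c = 0 \<and> Y a (0 + int i) c = 0"
    using N unfolding M_def by auto
  then have "(\<Sum>i<M. sc (of_int 0 gchoose i) (Y (Y a (k + int i) b) (0 + q - int i) c)) =
      (\<Sum>i<M. sc ((-1) ^ i * (of_int k gchoose i))
        (Y a (0 + k - int i) (Y b (q + int i) c)
         - sc (if even k then 1 else -1) (Y b (q + k - int i) (Y a (0 + int i) c))))"
    using borcherds unfolding borcherds_identity_def by blast
  moreover have "(\<Sum>i<M. sc (of_int 0 gchoose i) (Y (Y a (k + int i) b) (0 + q - int i) c)) =
      (\<Sum>i\<in>{0}. sc (of_int 0 gchoose i) (Y (Y a (k + int i) b) (0 + q - int i) c))"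
    by (intro sum.mono_neutral_right) (auto simp: M_def gbinomial_0_left)
  ultimately show thesis
    using that[of M] by simp
qed

definition left_stabilizer :: "'v set \<Rightarrow> 'v set" where
  "left_stabilizer H = {a. \<forall>n. \<forall>h\<in>H. Y a n h \<in> H}"

lemma additive_subgroup_left_stabilizer:
  assumes "additive_subgroup H"
  shows "additive_subgroup (left_stabilizer H)"
proof -
  have "left_stabilizer H = (\<Inter>n. \<Inter>h\<in>H. (\<lambda>a. Y a n h) -` H)"
    by (auto simp: left_stabilizer_def)
  then show ?thesis
    using assms by (simp add: additive_subgroup_INT additive_subgroup_vimage[OF Y_left_hom])
qed

lemma product_closed_left_stabilizer:
  assumes H: "additive_subgroup H"
  shows "product_closed Y (left_stabilizer H)"
proof -
  have "Y (Y a k b) n h \<in> H"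
    if a: "a \<in> left_stabilizer H" and b: "b \<in> left_stabilizer H" and h: "h \<in> H"
    for a b h and k n :: int
  proof -
    obtain M where "Y (Y a k b) n h =
      (\<Sum>i<M. sc ((-1) ^ i * (of_int k gchoose i))
        (Y a (k - int i) (Y b (n + int i) h) -
         sc (if even k then 1 else -1) (Y b (n + k - int i) (Y a (int i) h))))"
      by (rule Y_iterate_expansion)
    also have "\<dots> \<in> H"
    proof (intro additive_subgroup_sum[OF H] additive_subgroup_scale_Ints[OF H]
        additive_subgroup_diff[OF H])
      show "(-1) ^ i * (of_int k gchoose i) \<in> (\<int> :: rat set)" for i
        by (intro Ints_mult Ints_power) (simp_all flip: of_int_gbinomial)
    qed (use a b h in \<open>auto simp: left_stabilizer_def\<close>)
    finally show ?thesis .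
  qed
  then show ?thesis by (auto simp: product_closed_def left_stabilizer_def)
qed

lemma integral_form_additive: "integral_form sc Y vac om S J \<Longrightarrow> additive_subgroup J"
  and integral_form_product_closed: "integral_form sc Y vac om S J \<Longrightarrow> product_closed Y J"
  by (auto simp: integral_form_def)

lemma integral_form_span: "integral_form sc Y vac om S J \<Longrightarrow> span J = S"
  unfolding integral_form_def using span_zspan by blast

lemma integral_form_Int_finite_dim:
  assumes J: "integral_form sc Y vac om S J" and U: "subspace U" "U \<subseteq> span T" "finite T"
  obtains C where "finite C" "J \<inter> U = zspan sc C"
proof -
  obtain B where "independent B" "J = zspan sc B" using J unfolding integral_form_def by blast
  moreover have "additive_subgroup (J \<inter> U)"
    by (intro additive_subgroup_Int integral_form_additive[OF J] subspace_imp_additive_subgroup U)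
  ultimately show thesis
    using subgroup_of_free_finite_basis[of B "J \<inter> U" T] U(2,3) that by blast
qed

lemma integral_form_spanning_subring:
  assumes J: "integral_form sc Y vac om UNIV J" and "J' \<subseteq> J"
    and J': "additive_subgroup J'" "product_closed Y J'" "span J' = UNIV"
  shows "integral_form sc Y vac om UNIV J'"
proof -
  obtain B where B: "independent B" "J = zspan sc B" using J unfolding integral_form_def by blast
  obtain B' where "independent B'" "J' = zspan sc B'"
    by (rule subgroup_of_free_is_free[OF B(1) J'(1)]) (use \<open>J' \<subseteq> J\<close> B(2) in auto)
  moreover from this have "span B' = UNIV" using J'(3) span_zspan by simp
  ultimately show ?thesis
    using J' span_multiple_in_additive_subgroup[OF J'(1)]
    unfolding integral_form_def by blast
qed

end

section \<open>The dual lattice of the graded part\<close>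

context voa
begin

text \<open>By invariance of the form, the adjoint of a mode \<open>Y f n\<close> is, up to sign, a sum of modes of the
  elements \<open>L(1)\<^sup>j f / j!\<close>.\<close>

definition adjoint_stable :: "'v set \<Rightarrow> 'v set" where
  "adjoint_stable J = {f \<in> homogeneous. \<forall>j. sc (1 / fact j) ((L1 ^^ j) f) \<in> J}"

lemma adjoint_stable_subset: "adjoint_stable J \<subseteq> J"
proof
  fix f assume "f \<in> adjoint_stable J"
  then have "sc (1 / fact 0) ((L1 ^^ 0) f) \<in> J" unfolding adjoint_stable_def by blast
  then show "f \<in> J" by simp
qed

lemma adjoint_stable_if_L1_zero:
  assumes "f \<in> J" "f \<in> homogeneous" "L1 f = 0" "0 \<in> J"
  shows "f \<in> adjoint_stable J"
proof -
  have "sc (1 / fact j) ((L1 ^^ j) f) \<in> J" for j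
    using assms by (cases j) (simp_all add: funpow_Suc_right del: funpow.simps(2))
  then show ?thesis using assms(2) by (simp add: adjoint_stable_def)
qed

lemma adjoint_stable_multiple:
  assumes J: "additive_subgroup J" "span J = UNIV" and f: "f \<in> homogeneous"
  obtains m :: nat where "m > 0" "sc (of_nat m) f \<in> adjoint_stable J"
proof -
  obtain k where k: "f \<in> grade k" using f by (auto simp: homogeneous_def)
  obtain M where M: "\<And>j. j \<ge> M \<Longrightarrow> (L1 ^^ j) f = 0" using L1_nilpotent[OF k] by blast
  let ?X = "(\<lambda>j. sc (1 / fact j) ((L1 ^^ j) f)) ` {..<M}"
  have "\<exists>m::nat. m > 0 \<and> sc (of_nat m) x \<in> J" for x
    using span_multiple_in_additive_subgroup[OF J(1)] J(2) by simp
  then obtain m :: nat where m: "m > 0" "\<forall>x\<in>?X. sc (of_nat m) x \<in> J"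
    using additive_subgroup_common_multiple[OF J(1), of ?X] by auto
  have "sc (1 / fact j) ((L1 ^^ j) (sc (of_nat m) f)) \<in> J" for j
  proof (cases "j < M")
    case True
    then have "sc (of_nat m) (sc (1 / fact j) ((L1 ^^ j) f)) \<in> J" using m(2) by blast
    then show ?thesis by (simp add: L1_pow.scale)
  next
    case False
    then show ?thesis using M[of j] J(1) by (simp add: L1_pow.scale additive_subgroup_def)
  qed
  moreover have "sc (of_nat m) f \<in> homogeneous"
    using subspace_scale[OF subspace_grade k] by (auto simp: homogeneous_def)
  ultimately have "sc (of_nat m) f \<in> adjoint_stable J" by (simp add: adjoint_stable_def)
  then show thesis by (rule that[OF m(1)])
qed

lemma span_adjoint_stable:
  assumes J: "additive_subgroup J" "span J = UNIV"
  shows "span (adjoint_stable J) = UNIV"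
proof -
  have "f \<in> span (adjoint_stable J)" if f: "f \<in> homogeneous" for f
  proof -
    obtain m :: nat where m: "m > 0" "sc (of_nat m) f \<in> adjoint_stable J"
      by (rule adjoint_stable_multiple[OF J f])
    have "sc (1 / of_nat m) (sc (of_nat m) f) \<in> span (adjoint_stable J)"
      by (intro span_scale span_base m(2))
    then show ?thesis using m(1) by simp
  qed
  then have "span homogeneous \<subseteq> span (adjoint_stable J)" by (intro span_minimal) auto
  then show ?thesis using span_homogeneous by auto
qed

lemma VOA_aut_adjoint_stable:
  assumes g: "VOA_aut sc Y vac om g" and J: "g ` J \<subseteq> J" and f: "f \<in> adjoint_stable J"
  shows "g f \<in> adjoint_stable J"
proof -
  have "sc (1 / fact j) ((L1 ^^ j) (g f)) \<in> J" for j
  proof -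
    have "g (sc (1 / fact j) ((L1 ^^ j) f)) \<in> J" using f J unfolding adjoint_stable_def by blast
    then show ?thesis
      by (simp add: module_hom.scale[OF VOA_aut_hom[OF g]] VOA_aut_L1_pow[OF g])
  qed
  moreover have "g f \<in> homogeneous"
    using f VOA_aut_grade[OF g] by (auto simp: adjoint_stable_def homogeneous_def)
  ultimately show ?thesis by (simp add: adjoint_stable_def)
qed

definition graded_part :: "'v set \<Rightarrow> 'v set" where
  "graded_part J = zspan sc (J \<inter> homogeneous)"

lemma product_closed_graded_part:
  assumes "product_closed Y J"
  shows "product_closed Y (graded_part J)"
  unfolding graded_part_def
proof (rule product_closed_zspan)
  fix a b k assume "a \<in> J \<inter> homogeneous" "b \<in> J \<inter> homogeneous"
  then have "Y a k b \<in> J \<inter> homogeneous"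
    using assms Y_grade by (fastforce simp: product_closed_def homogeneous_def)
  then show "Y a k b \<in> zspan sc (J \<inter> homogeneous)" by (rule zspan_base)
qed

lemma adjoint_stable_graded_part:
  assumes "f \<in> adjoint_stable J"
  shows "sc (1 / fact j) ((L1 ^^ j) f) \<in> graded_part J"
proof -
  obtain k where "f \<in> grade k" using assms by (auto simp: adjoint_stable_def homogeneous_def)
  then have "sc (1 / fact j) ((L1 ^^ j) f) \<in> grade (k - int j)"
    by (intro subspace_scale[OF subspace_grade] L1_pow_grade)
  then show ?thesis
    using assms
    by (auto simp: graded_part_def adjoint_stable_def homogeneous_def intro!: zspan_base)
qed

lemma adjoint_stable_subset_graded_part: "adjoint_stable J \<subseteq> graded_part J"
  using adjoint_stable_subset zspan_superset[of "J \<inter> homogeneous"]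
  by (auto simp: graded_part_def adjoint_stable_def)

end

locale voa_form = voa sc Y vac om grade
  for sc :: "rat \<Rightarrow> 'v::ab_group_add \<Rightarrow> 'v" and Y vac om grade +
  fixes form :: "'v \<Rightarrow> 'v \<Rightarrow> rat"
  assumes natural: "natural_form sc Y vac om grade form"
begin

lemma form_left_hom: "module_hom sc (*) (\<lambda>a. form a b)"
  and form_right_hom: "module_hom sc (*) (form a)"
  using natural module_axioms
  by (auto simp: natural_form_def module_hom_iff algebra_simps intro!: module.intro)

sublocale form_left: module_hom sc "(*)" "\<lambda>a. form a b" for b
  by (rule form_left_hom)

sublocale form_right: module_hom sc "(*)" "form a" for a
  by (rule form_right_hom)

lemma form_invariant:
  assumes "a \<in> grade k" "\<And>j. j \<ge> M \<Longrightarrow> (L1 ^^ j) a = 0"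
  shows "form (Y a n b) c = (if even k then 1 else -1) *
    (\<Sum>j<M. form b (Y ((L1 ^^ j) a) (2 * k - n - int j - 2) c) / fact j)"
  using natural assms unfolding natural_form_def by blast

lemma form_vac_homogeneous:
  assumes v: "v \<in> grade k" and k: "k \<noteq> 0"
  shows "form vac v = 0"
proof -
  have "(L1 ^^ j) om = 0" if "j \<ge> 1" for j
    using that by (cases j) (simp_all add: funpow_Suc_right L1_om del: funpow.simps(2))
  then have "form (Y om 1 vac) v = form vac (Y om 1 v)"
    using form_invariant[OF om_grade, of 1 1 vac v] by simp
  then show ?thesis using k by (simp add: Y_vac_right_nonneg L0_grade[OF v] form_right.scale)
qed

definition dual :: "'v set \<Rightarrow> 'v set" where
  "dual L = {h. \<forall>v\<in>L. form h v \<in> \<int>}"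

lemma additive_subgroup_dual: "additive_subgroup (dual L)"
proof -
  have "dual L = (\<Inter>v\<in>L. (\<lambda>h. form h v) -` \<int>)" by (auto simp: dual_def)
  then show ?thesis
    by (simp add: additive_subgroup_INT additive_subgroup_vimage[OF form_left_hom]
        additive_subgroup_Ints)
qed

lemma dual_zspan: "dual (zspan sc S) = dual S"
proof
  show "dual (zspan sc S) \<subseteq> dual S" using zspan_superset[of S] by (auto simp: dual_def)
  have "zspan sc S \<subseteq> form h -` \<int>" if "h \<in> dual S" for h
    using that
    by (intro zspan_minimal additive_subgroup_vimage[OF form_right_hom] additive_subgroup_Ints)
      (auto simp: dual_def)
  then show "dual S \<subseteq> dual (zspan sc S)" by (auto simp: dual_def)
qed

lemma vac_multiple_in_dual_graded_part:
  assumes J: "integral_form sc Y vac om UNIV J"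
  obtains m :: nat where "m > 0" "sc (of_nat m) vac \<in> dual (graded_part J)"
proof -
  obtain B where "finite B" "grade 0 \<subseteq> span B" using grade_finite_dim by blast
  then obtain C where C: "finite C" "J \<inter> grade 0 = zspan sc C"
    using integral_form_Int_finite_dim[OF J subspace_grade] by metis
  have "\<exists>m::nat. m > 0 \<and> sc (of_nat m) c \<in> form vac -` \<int>" for c
    by (rule rat_multiple_Ints[of "form vac c"]) (auto simp: form_right.scale)
  then obtain m :: nat where m: "m > 0" "\<forall>c\<in>C. sc (of_nat m) c \<in> form vac -` \<int>"
    by (rule additive_subgroup_common_multiple[OF additive_subgroup_vimage[OF form_right_hom
            additive_subgroup_Ints] C(1)])
  then have "sc (of_nat m) vac \<in> dual C"
    by (simp add: dual_def form_left.scale form_right.scale)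
  then have degree_zero: "sc (of_nat m) vac \<in> dual (J \<inter> grade 0)" by (simp add: C(2) dual_zspan)
  have "form (sc (of_nat m) vac) v \<in> \<int>" if v: "v \<in> J" "v \<in> grade k" for v k
  proof (cases "k = 0")
    case True
    then show ?thesis using degree_zero v by (simp add: dual_def)
  next
    case False
    then show ?thesis by (simp add: form_left.scale form_vac_homogeneous[OF v(2)])
  qed
  then have "sc (of_nat m) vac \<in> dual (graded_part J)"
    unfolding graded_part_def dual_zspan by (auto simp: dual_def homogeneous_def)
  then show thesis by (rule that[OF m(1)])
qed

lemma adjoint_stable_stabilizes_dual:
  assumes J: "product_closed Y J"
  shows "adjoint_stable J \<subseteq> left_stabilizer (dual (graded_part J))"
proof
  fix f assume f: "f \<in> adjoint_stable J"
  obtain k where k: "f \<in> grade k" using f by (auto simp: adjoint_stable_def homogeneous_def)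
  obtain M where M: "\<And>j. j \<ge> M \<Longrightarrow> (L1 ^^ j) f = 0" using L1_nilpotent[OF k] by blast
  have "form (Y f n h) v \<in> \<int>" if h: "h \<in> dual (graded_part J)" and v: "v \<in> graded_part J" for n h v
  proof -
    let ?d = "\<lambda>j. sc (1 / fact j) ((L1 ^^ j) f)"
    have "form h (Y (?d j) i v) \<in> \<int>" for i j
      using h v adjoint_stable_graded_part[OF f] product_closed_graded_part[OF J]
      by (simp add: dual_def product_closed_def)
    then have "(\<Sum>j<M. form h (Y (?d j) (2 * k - n - int j - 2) v)) \<in> \<int>"
      by (intro Ints_sum)
    moreover have "form (Y f n h) v =
        (if even k then 1 else -1) * (\<Sum>j<M. form h (Y (?d j) (2 * k - n - int j - 2) v))"
      by (simp add: form_invariant[OF k M] Y_left.scale form_right.scale)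
    ultimately show ?thesis by simp
  qed
  then show "f \<in> left_stabilizer (dual (graded_part J))"
    by (simp add: left_stabilizer_def dual_def)
qed

lemma nearly_lattice_integralI:
  assumes "m > 0" "\<And>x y. x \<in> A \<Longrightarrow> y \<in> A \<Longrightarrow> of_nat m * form x y \<in> \<int>"
  shows "nearly_lattice_integral sc form A"
proof -
  have "form (sc (of_nat m) x) (sc (of_nat m) y) \<in> \<int>" if "x \<in> A" "y \<in> A" for x y
    using Ints_mult[OF Ints_of_nat[of m] assms(2)[OF that]]
    by (simp add: form_left.scale form_right.scale)
  then show ?thesis
    using assms(1) unfolding nearly_lattice_integral_def lattice_integral_def by blast
qed

lemma adjoint_stable_nearly_lattice_integral:
  assumes J: "integral_form sc Y vac om UNIV J" and F: "F \<subseteq> adjoint_stable J"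
  shows "nearly_lattice_integral sc form (generated_closure Y F)"
proof -
  let ?L = "graded_part J"
  have closed: "product_closed Y J" by (rule integral_form_product_closed[OF J])
  have sub: "generated_closure Y F \<subseteq> ?L"
  proof (rule generated_closure_minimal)
    show "F \<subseteq> ?L" using F adjoint_stable_subset_graded_part by blast
    show "additive_subgroup ?L" unfolding graded_part_def by (rule additive_subgroup_zspan)
  qed (rule product_closed_graded_part[OF closed])
  have stab: "generated_closure Y F \<subseteq> left_stabilizer (dual ?L)"
    using F adjoint_stable_stabilizes_dual[OF closed]
    by (intro generated_closure_minimal additive_subgroup_left_stabilizer
        product_closed_left_stabilizer additive_subgroup_dual) auto
  obtain m :: nat where m: "m > 0" "sc (of_nat m) vac \<in> dual ?L"
    by (rule vac_multiple_in_dual_graded_part[OF J])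
  show ?thesis
  proof (rule nearly_lattice_integralI[OF m(1)])
    fix x y assume x: "x \<in> generated_closure Y F" and y: "y \<in> generated_closure Y F"
    have "Y x (-1) (sc (of_nat m) vac) \<in> dual ?L"
      using x stab m(2) by (auto simp: left_stabilizer_def)
    then have "sc (of_nat m) x \<in> dual ?L" by (simp add: Y_right.scale Y_vac_right)
    then show "of_nat m * form x y \<in> \<int>"
      using y sub by (auto simp: dual_def form_left.scale)
  qed
qed

end

section \<open>Finitely generated integral forms\<close>

context voa
begin

lemma span_VOA_translates_of_fixed_points:
  assumes N: "finite_aut_group sc Y vac om N"
    and E: "normal_subgroup E N" "iso_Z2_power E r"
    and trans: "transitive_on_nontrivial_chars N E"
    and D: "is_subgroup D E" "D \<noteq> E"
  shows "span (\<Union>g\<in>N. g ` fixed_points D) = UNIV"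
proof (rule span_translates_of_fixed_points[OF _ _ E(1) _ _ trans D])
  have EN: "is_subgroup E N" using E(1) by (simp add: normal_subgroup_def)
  then show "involution_group E" using E(2) by (rule iso_Z2_power_involution_group)
  have "E \<subseteq> N" using EN by (simp add: is_subgroup_def)
  then show "finite E" using finite_aut_group_finite[OF N] by (rule finite_subset)
  show "bij g" if "g \<in> N" for g
    using finite_aut_group_VOA_aut[OF N that] by (simp add: VOA_aut_def)
  show "module_hom sc sc e" if "e \<in> E" for e
    using subsetD[OF \<open>E \<subseteq> N\<close> that] by (intro VOA_aut_hom finite_aut_group_VOA_aut[OF N])
qed

definition rational_generators :: "'v set \<Rightarrow> bool" where
  "rational_generators T \<longleftrightarrow> (\<forall>U. subspace U \<longrightarrow> product_closed Y U \<longrightarrow> T \<subseteq> U \<longrightarrow> U = UNIV)"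

lemma rational_generators_translates:
  assumes N: "\<And>g. g \<in> N \<Longrightarrow> VOA_aut sc Y vac om g"
    and W: "span (\<Union>g\<in>N. g ` span (generated_closure Y F)) = UNIV"
  shows "rational_generators (\<Union>g\<in>N. g ` F)"
  unfolding rational_generators_def
proof (intro allI impI)
  fix U assume U: "subspace U" "product_closed Y U" "(\<Union>g\<in>N. g ` F) \<subseteq> U"
  have "g ` span (generated_closure Y F) \<subseteq> U" if g: "g \<in> N" for g
  proof -
    interpret g: module_hom sc sc g by (rule VOA_aut_hom[OF N[OF g]])
    have "g ` generated_closure Y F \<subseteq> U"
      using U g
      by (intro VOA_aut_generated_closure N subspace_imp_additive_subgroup) auto
    then have "span (g ` generated_closure Y F) \<subseteq> U" using U(1) by (rule span_minimal)
    then show ?thesis by (simp add: g.span_image)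
  qed
  then have "span (\<Union>g\<in>N. g ` span (generated_closure Y F)) \<subseteq> U"
    using U(1) by (intro span_minimal) auto
  then show "U = UNIV" using W by auto
qed

lemma quasiprimary_line_generators:
  assumes J: "integral_form sc Y vac om UNIV J" and x: "x \<in> grade k" "L1 x = 0"
  obtains C where "finite C" "C \<subseteq> adjoint_stable J" "J \<inter> range (\<lambda>q. sc q x) = zspan sc C"
proof -
  obtain C where C: "finite C" "J \<inter> span {x} = zspan sc C"
    by (rule integral_form_Int_finite_dim[OF J subspace_span order_refl, of "{x}"]) auto
  have "c \<in> adjoint_stable J" if "c \<in> C" for c
  proof -
    have c: "c \<in> J" "c \<in> span {x}" using that zspan_base[of c C] C(2) by auto
    then obtain q where "c = sc q x" by (auto simp: span_singleton)
    then have "c \<in> homogeneous" "L1 c = 0"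
      using x subspace_scale[OF subspace_grade x(1)] by (auto simp: homogeneous_def Y_right.scale)
    then show ?thesis
      using c(1) integral_form_additive[OF J]
      by (intro adjoint_stable_if_L1_zero) (auto simp: additive_subgroup_def)
  qed
  then have "C \<subseteq> adjoint_stable J" by blast
  then show thesis using that[OF C(1)] C(2) by (simp add: span_singleton)
qed

lemma adjoint_stable_generators:
  assumes J: "integral_form sc Y vac om UNIV J" and T: "finite T"
  obtains F where "finite F" "F \<subseteq> adjoint_stable J" "T \<subseteq> span F"
    "J \<inter> range (\<lambda>q. sc q vac) \<subseteq> zspan sc F" "J \<inter> range (\<lambda>q. sc q om) \<subseteq> zspan sc F"
proof -
  obtain B where B: "finite B" "B \<subseteq> adjoint_stable J"
    "J \<inter> range (\<lambda>q. sc q vac) = zspan sc B"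
    by (rule quasiprimary_line_generators[OF J vac_grade L1_vac])
  obtain C where C: "finite C" "C \<subseteq> adjoint_stable J"
    "J \<inter> range (\<lambda>q. sc q om) = zspan sc C"
    by (rule quasiprimary_line_generators[OF J om_grade L1_om])
  obtain H where H: "finite H" "H \<subseteq> adjoint_stable J" "T \<subseteq> span H"
    using finite_subset_span_finite[OF T, of "adjoint_stable J"]
      span_adjoint_stable[OF integral_form_additive[OF J] integral_form_span[OF J]] by auto
  show thesis
  proof
    show "finite (H \<union> B \<union> C)" using H(1) B(1) C(1) by simp
    show "H \<union> B \<union> C \<subseteq> adjoint_stable J" using H(2) B(2) C(2) by simp
    show "T \<subseteq> span (H \<union> B \<union> C)" using H(3) span_mono[of H "H \<union> B \<union> C"] by blast
    show "J \<inter> range (\<lambda>q. sc q vac) \<subseteq> zspan sc (H \<union> B \<union> C)"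
      unfolding B(3) by (rule zspan_mono) blast
    show "J \<inter> range (\<lambda>q. sc q om) \<subseteq> zspan sc (H \<union> B \<union> C)"
      unfolding C(3) by (rule zspan_mono) blast
  qed
qed

lemma adjoint_stable_orbit:
  assumes G: "finite_aut_group sc Y vac om G" "\<forall>g\<in>G. g ` J \<subseteq> J" and F: "F \<subseteq> adjoint_stable J"
  shows "(\<Union>g\<in>G. g ` F) \<subseteq> adjoint_stable J"
proof (intro UN_least image_subsetI)
  fix g f assume g: "g \<in> G" and f: "f \<in> F"
  show "g f \<in> adjoint_stable J"
    using finite_aut_group_VOA_aut[OF G(1) g] bspec[OF G(2) g] subsetD[OF F f]
    by (rule VOA_aut_adjoint_stable)
qed

lemma VOA_aut_generated_closure_orbit:
  assumes G: "finite_aut_group sc Y vac om G" and g: "g \<in> G"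
  shows "g ` generated_closure Y (\<Union>h\<in>G. h ` F) \<subseteq> generated_closure Y (\<Union>h\<in>G. h ` F)"
proof (rule VOA_aut_generated_closure)
  show "VOA_aut sc Y vac om g" by (rule finite_aut_group_VOA_aut[OF G g])
  have "g ` (\<Union>h\<in>G. h ` F) = (\<Union>h\<in>G. (g \<circ> h) ` F)" by (simp add: image_UN image_comp)
  also have "\<dots> \<subseteq> (\<Union>h\<in>G. h ` F)"
  proof (rule UN_least)
    fix h assume "h \<in> G"
    then have "g \<circ> h \<in> G" by (rule finite_aut_group_comp[OF G g])
    then show "(g \<circ> h) ` F \<subseteq> (\<Union>h\<in>G. h ` F)" by (rule UN_upper)
  qed
  also have "\<dots> \<subseteq> generated_closure Y (\<Union>h\<in>G. h ` F)" by (rule generated_closure_superset)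
  finally show "g ` (\<Union>h\<in>G. h ` F) \<subseteq> generated_closure Y (\<Union>h\<in>G. h ` F)" .
qed (rule additive_subgroup_generated_closure product_closed_generated_closure)+

lemma integral_form_generated_closure:
  assumes J: "integral_form sc Y vac om UNIV J" and F: "F \<subseteq> J"
    and T: "rational_generators T" "T \<subseteq> span F"
  shows "integral_form sc Y vac om UNIV (generated_closure Y F)"
proof (rule integral_form_spanning_subring[OF J])
  show "generated_closure Y F \<subseteq> J"
    by (intro generated_closure_minimal F integral_form_additive[OF J]
        integral_form_product_closed[OF J])
  have "product_closed Y (span (generated_closure Y F))"
    by (intro product_closed_span product_closed_generated_closure)
  moreover have "T \<subseteq> span (generated_closure Y F)"
    using T(2) span_mono[OF generated_closure_superset[of F Y]] by blast
  ultimately show "span (generated_closure Y F) = UNIV"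
    using T(1) by (simp add: rational_generators_def)
qed (rule additive_subgroup_generated_closure product_closed_generated_closure)+

end

theorem (in voa_form) finitely_generated_subform_exists:
  assumes T: "finite T" "rational_generators T"
    and G: "finite_aut_group sc Y vac om G"
    and J: "integral_form sc Y vac om UNIV J" and GJ: "\<forall>g\<in>G. g ` J \<subseteq> J"
  shows "\<exists>J'\<subseteq>J. integral_form sc Y vac om UNIV J' \<and>
    finitely_generated Y J' \<and> nearly_lattice_integral sc form J' \<and>
    (\<forall>g\<in>G. g ` J' \<subseteq> J') \<and>
    J' \<inter> range (\<lambda>q. sc q vac) = J \<inter> range (\<lambda>q. sc q vac) \<and>
    J' \<inter> range (\<lambda>q. sc q om) = J \<inter> range (\<lambda>q. sc q om)"
proof -
  obtain F where F: "finite F" "F \<subseteq> adjoint_stable J" "T \<subseteq> span F"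
    and lines: "J \<inter> range (\<lambda>q. sc q vac) \<subseteq> zspan sc F" "J \<inter> range (\<lambda>q. sc q om) \<subseteq> zspan sc F"
    by (rule adjoint_stable_generators[OF J T(1)])
  define F' where "F' = (\<Union>g\<in>G. g ` F)"
  define J' where "J' = generated_closure Y F'"
  have F'_stable: "F' \<subseteq> adjoint_stable J"
    unfolding F'_def by (rule adjoint_stable_orbit[OF G GJ F(2)])
  have F'_J: "F' \<subseteq> J" using F'_stable adjoint_stable_subset by (rule subset_trans)
  have F_F': "F \<subseteq> F'"
    using UN_upper[OF finite_aut_group_id[OF G], of "\<lambda>g. g ` F"] by (simp add: F'_def)
  have "J' \<subseteq> J"
    unfolding J'_def by (intro generated_closure_minimal F'_J integral_form_additive[OF J]
        integral_form_product_closed[OF J])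
  moreover have "T \<subseteq> span F'" using F(3) span_mono[OF F_F'] by (rule subset_trans)
  then have "integral_form sc Y vac om UNIV J'"
    unfolding J'_def by (rule integral_form_generated_closure[OF J F'_J T(2)])
  moreover have "finite F'" using finite_aut_group_finite[OF G] F(1) by (simp add: F'_def)
  then have "finitely_generated Y J'" unfolding finitely_generated_def J'_def by blast
  moreover have "nearly_lattice_integral sc form J'"
    unfolding J'_def by (rule adjoint_stable_nearly_lattice_integral[OF J F'_stable])
  moreover have "\<forall>g\<in>G. g ` J' \<subseteq> J'"
    unfolding J'_def F'_def using VOA_aut_generated_closure_orbit[OF G] by blast
  moreover have "zspan sc F \<subseteq> J'"
    unfolding J'_def using F_F' generated_closure_superset additive_subgroup_generated_closure
    by (intro zspan_minimal) (rule subset_trans)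
  ultimately show ?thesis using lines by (intro exI[of _ J'] conjI) blast+
qed

theorem theorem2p8:
  fixes sc :: "rat \<Rightarrow> 'v::ab_group_add \<Rightarrow> 'v"
    and Y :: "'v \<Rightarrow> int \<Rightarrow> 'v \<Rightarrow> 'v"
    and vac om :: 'v
    and grade :: "int \<Rightarrow> 'v set"
    and form :: "'v \<Rightarrow> 'v \<Rightarrow> rat"
    and N E D :: "('v \<Rightarrow> 'v) set"
    and r :: nat
    and K :: "'v set"
  assumes VOA: "is_VOA sc Y vac om grade"
    and form: "natural_form sc Y vac om grade form"
    and N: "finite_aut_group sc Y vac om N"
    and E_normal: "normal_subgroup E N"
    and E_iso: "iso_Z2_power E r"
    and r: "r \<ge> 2"
    and trans: "transitive_on_nontrivial_chars N E"
    and D: "is_subgroup D E"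
    and rank: "D \<noteq> E"
    and K_IF: "integral_form sc Y vac om (fixed_points D) K"
    and K_fg: "finitely_generated Y K"
    and K_nli: "nearly_lattice_integral sc form K"
  shows "(\<forall>J. integral_form sc Y vac om UNIV J \<longrightarrow>
            (\<exists>J'. J' \<subseteq> J \<and> integral_form sc Y vac om UNIV J' \<and>
                  finitely_generated Y J' \<and> nearly_lattice_integral sc form J'))
       \<and> (\<forall>G J. finite_aut_group sc Y vac om G \<longrightarrow> integral_form sc Y vac om UNIV J \<longrightarrow>
            (\<forall>g\<in>G. g ` J \<subseteq> J) \<longrightarrow>
            (\<exists>J'. J' \<subseteq> J \<and> integral_form sc Y vac om UNIV J' \<and>
                  finitely_generated Y J' \<and> nearly_lattice_integral sc form J' \<and>
                  (\<forall>g\<in>G. g ` J' \<subseteq> J') \<and>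
                  J' \<inter> range (\<lambda>q. sc q vac) = J \<inter> range (\<lambda>q. sc q vac) \<and>
                  J' \<inter> range (\<lambda>q. sc q om) = J \<inter> range (\<lambda>q. sc q om)))"
proof -
  interpret voa_form sc Y vac om grade form
    using VOA form by unfold_locales
  obtain F where F: "finite F" "K = generated_closure Y F"
    using K_fg unfolding finitely_generated_def by blast
  then have "span (generated_closure Y F) = fixed_points D"
    using integral_form_span[OF K_IF] by simp
  then have gens: "rational_generators (\<Union>g\<in>N. g ` F)"
    using span_VOA_translates_of_fixed_points[OF N E_normal E_iso trans D rank]
    by (intro rational_generators_translates finite_aut_group_VOA_aut[OF N]) simp_all
  have "finite (\<Union>g\<in>N. g ` F)" using finite_aut_group_finite[OF N] F(1) by simp
  note subform = finitely_generated_subform_exists[OF this gens]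
  show ?thesis
  proof (intro conjI allI impI)
    fix J assume "integral_form sc Y vac om UNIV J"
    from subform[OF finite_aut_group_trivial this]
    show "\<exists>J'\<subseteq>J. integral_form sc Y vac om UNIV J' \<and> finitely_generated Y J' \<and>
        nearly_lattice_integral sc form J'" by auto
  qed (rule subform)
qed

end
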